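(* Let $E$ be a locally compact separable metric space and $m$ a positive Radon measure on $E$ with full topological support. Let $X=(\Omega,X_t,\mathbb{P}_x,\zeta)$ be an explosive $m$-symmetric Markov process on $E$ in Class (T) (i.e. irreducible, strong Feller and with the tightness property). Let $\phi_0$ be its ground state, taken in its strictly positive, bounded continuous version. Then the probability measure $$\nu^{\phi_0}(B)=\frac{\int_B\phi_0\,dm}{\int_E\phi_0\,dm},\qquad B\in\mathscr{B}(E),$$ is the unique quasi-stationary distribution of $X$.
   Context: Setting and notation: $\mathscr{B}(E)$ is the Borel $\sigma$-algebra of $E$, $b\mathscr{B}(E)$ the bounded Borel functions and $bC(E)$ the bounded continuous functions on $E$. $X$ lives on $E$ with an adjoined cemetery point $\Delta$ (the one-point compactification point); $\zeta=\inf\{t>0: X_t=\Delta\}$ is the lifetime, and functions on $E$ are extended by $0$ at $\Delta$. The semigroup and resolvent are $p_tf(x)=\mathbb{E}_x(f(X_t))$ and $R_\alpha f(x)=\mathbb{E}_x\left(\int_0^\infty e^{-\alpha t}f(X_t)\,dt\right)$. $m$-symmetric means $\int_E (p_tf)g\,dm=\int_E f\,(p_tg)\,dm$. Class (T): $X$ is in Class (T) if it satisfies (I) Irreducibility: if a Borel set $A$ satisfies $p_t(1_Af)=1_Ap_tf$ $m$-a.e. for all $f\in L^2(E;m)\cap b\mathscr{B}(E)$ and $t>0$, then $m(A)=0$ or $m(E\setminus A)=0$; (II) Strong Feller property: $p_t(b\mathscr{B}(E))\subset bC(E)$ for each $t>0$; (III) Tightness: for any $\epsilon>0$ there is a compact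 set $K\subset E$ with $\sup_{x\in E}R_11_{K^c}(x)\le\epsilon$. Explosive means not conservative, i.e. it is not the case that $\mathbb{P}_x(\zeta=\infty)=1$ for all $x\in E$. Dirichlet form: $\mathcal{D}(\mathcal{E})=\{u\in L^2(E;m): \lim_{t\to0}\frac1t(u-p_tu,u)_m<\infty\}$, $\mathcal{E}(u,v)=\lim_{t\to0}\frac1t(u-p_tu,v)_m$, where $(\cdot,\cdot)_m$ is the $L^2(E;m)$ inner product. Put $\lambda_0=\inf\{\mathcal{E}(u,u): u\in\mathcal{D}(\mathcal{E}),\ \|u\|_2=1\}$. A ground state is a function $\phi_0\in\mathcal{D}(\mathcal{E})$ with $\|\phi_0\|_2=1$ and $\mathcal{E}(\phi_0,\phi_0)=\lambda_0$. Under the stated hypotheses it exists, has a bounded continuous version with $\phi_0(x)>0$ for all $x\in E$, and belongs to $L^1(E;m)$, so $\nu^{\phi_0}$ is well defined. Quasi-stationary distribution: a probability measure $\nu$ on $E$ such that for all $t\ge0$ and all $B\in\mathscr{B}(E)$, $$\nu(B)=\mathbb{P}_\nu(X_t\in B\mid t<\zeta)=\frac{\mathbb{P}_\nu(X_t\in B)}{\mathbb{P}_\nu(X_t\in E)},$$ where $\mathbb{P}_\nu(\cdot)=\int_E\mathbb{P}_x(\cdot)\,d\nu(x)$. *)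

theory Defs
  imports "HOL-Probability.Probability"
begin

section \<open>The state space\<close>

definition radon_measure :: "'a::topological_space measure \<Rightarrow> bool" where
  "radon_measure m \<longleftrightarrow>
     sets m = sets borel \<and>
     (\<forall>K. compact K \<longrightarrow> emeasure m K < \<infinity>) \<and>
     (\<forall>B \<in> sets borel. emeasure m B = (SUP K \<in> {K. compact K \<and> K \<subseteq> B}. emeasure m K))"

definition full_topological_support :: "'a::topological_space measure \<Rightarrow> bool" where
  "full_topological_support m \<longleftrightarrow> (\<forall>U. open U \<and> U \<noteq> {} \<longrightarrow> emeasure m U > 0)"

text \<open>The cemetery point \<open>\<Delta>\<close> is \<^const>\<open>None\<close>, and \<open>E\<close> with \<open>\<Delta>\<close> adjoined is the
  one-point compactification, with its Borel \<open>\<sigma>\<close>-algebra.\<close>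

definition cemetery_borel :: "'a::topological_space option measure" where
  "cemetery_borel =
     sigma UNIV {U. openin (Alexandroff_compactification (euclidean :: 'a topology)) U}"

definition extend0 :: "('a \<Rightarrow> real) \<Rightarrow> 'a option \<Rightarrow> real" where
  "extend0 f z = (case z of None \<Rightarrow> 0 | Some x \<Rightarrow> f x)"


section \<open>Markov processes with lifetime\<close>

text \<open>Paths are indexed by real numbers, but only times \<open>t \<ge> 0\<close> are meaningful.\<close>

definition natural_filtration ::
    "'w measure \<Rightarrow> (real \<Rightarrow> 'w \<Rightarrow> 'a::topological_space option) \<Rightarrow> real \<Rightarrow> 'w measure" where
  "natural_filtration M X s =
     sigma (space M) {X r -` B \<inter> space M | r B. 0 \<le> r \<and> r \<le> s \<and> B \<in> sets cemetery_borel}"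

definition lifetime :: "(real \<Rightarrow> 'w \<Rightarrow> 'a option) \<Rightarrow> 'w \<Rightarrow> ereal" where
  "lifetime X \<omega> = Inf {ereal t | t. t > 0 \<and> X t \<omega> = None}"

text \<open>\<open>M\<close> carries the sample space and its \<open>\<sigma>\<close>-algebra only; the laws are the \<open>P z\<close>.
  Joint measurability of \<open>(t, \<omega>) \<mapsto> X t \<omega>\<close> is what the time integral in the resolvent requires.
  No path regularity is imposed except that the process is in \<open>E\<close> exactly before its lifetime;
  this makes \<open>\<Delta>\<close> a trap and makes the events \<open>X t \<in> E\<close> and \<open>t < \<zeta>\<close> equal.\<close>

locale markov_process =
  fixes M :: "'w measure"
    and X :: "real \<Rightarrow> 'w \<Rightarrow> 'a::topological_space option"
    and P :: "'a option \<Rightarrow> 'w measure"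
  assumes prob_space_P: "prob_space (P z)"
    and sets_P: "sets (P z) = sets M"
    and measurable_X:
      "(\<lambda>(t, \<omega>). X t \<omega>) \<in> restrict_space borel {0..} \<Otimes>\<^sub>M M \<rightarrow>\<^sub>M cemetery_borel"
    and measurable_transition:
      "t \<ge> 0 \<Longrightarrow> B \<in> sets cemetery_borel \<Longrightarrow>
         (\<lambda>z. measure (P z) {\<omega> \<in> space M. X t \<omega> \<in> B}) \<in> borel_measurable cemetery_borel"
    and normal: "AE \<omega> in P z. X 0 \<omega> = z"
    and markov_property:
      "s \<ge> 0 \<Longrightarrow> t \<ge> 0 \<Longrightarrow> B \<in> sets cemetery_borel \<Longrightarrow>
         AE \<omega> in P z.
           real_cond_exp (P z) (natural_filtration M X s) (\<lambda>\<omega>'. indicator B (X (s + t) \<omega>')) \<omega>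
             = measure (P (X s \<omega>)) {\<omega>' \<in> space M. X t \<omega>' \<in> B}"
    and lifetime:
      "\<omega> \<in> space M \<Longrightarrow> t \<ge> 0 \<Longrightarrow> X t \<omega> = None \<longleftrightarrow> lifetime X \<omega> \<le> ereal t"

definition conservative ::
    "(real \<Rightarrow> 'w \<Rightarrow> 'a option) \<Rightarrow> ('a option \<Rightarrow> 'w measure) \<Rightarrow> bool" where
  "conservative X P \<longleftrightarrow>
     (\<forall>x. measure (P (Some x)) {\<omega> \<in> space (P (Some x)). lifetime X \<omega> = \<infinity>} = 1)"

definition explosive ::
    "(real \<Rightarrow> 'w \<Rightarrow> 'a option) \<Rightarrow> ('a option \<Rightarrow> 'w measure) \<Rightarrow> bool" where
  "explosive X P \<longleftrightarrow> \<not> conservative X P"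

definition semigroup_op ::
    "(real \<Rightarrow> 'w \<Rightarrow> 'a option) \<Rightarrow> ('a option \<Rightarrow> 'w measure) \<Rightarrow>
     real \<Rightarrow> ('a \<Rightarrow> real) \<Rightarrow> 'a \<Rightarrow> real" where
  "semigroup_op X P t f x = (LINT \<omega>|P (Some x). extend0 f (X t \<omega>))"

definition resolvent_op ::
    "(real \<Rightarrow> 'w \<Rightarrow> 'a option) \<Rightarrow> ('a option \<Rightarrow> 'w measure) \<Rightarrow>
     real \<Rightarrow> ('a \<Rightarrow> real) \<Rightarrow> 'a \<Rightarrow> real" where
  "resolvent_op X P \<alpha> f x =
     (LINT \<omega>|P (Some x). (LINT t:{0..}|lborel. exp (- \<alpha> * t) * extend0 f (X t \<omega>)))"


section \<open>Symmetry and Class (T)\<close>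

definition bounded_borel :: "('a::topological_space \<Rightarrow> real) set" where
  "bounded_borel = {f. f \<in> borel_measurable borel \<and> bounded (range f)}"

definition bounded_cont :: "('a::topological_space \<Rightarrow> real) set" where
  "bounded_cont = {f. continuous_on UNIV f \<and> bounded (range f)}"

definition L2 :: "'a measure \<Rightarrow> ('a \<Rightarrow> real) set" where
  "L2 m = {u. u \<in> borel_measurable m \<and> integrable m (\<lambda>x. (u x)\<^sup>2)}"

definition L2_inner :: "'a measure \<Rightarrow> ('a \<Rightarrow> real) \<Rightarrow> ('a \<Rightarrow> real) \<Rightarrow> real" where
  "L2_inner m u v = (LINT x|m. u x * v x)"

definition L2_norm :: "'a measure \<Rightarrow> ('a \<Rightarrow> real) \<Rightarrow> real" where
  "L2_norm m u = sqrt (L2_inner m u u)"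

definition m_symmetric ::
    "'a::topological_space measure \<Rightarrow>
     (real \<Rightarrow> 'w \<Rightarrow> 'a option) \<Rightarrow> ('a option \<Rightarrow> 'w measure) \<Rightarrow> bool" where
  "m_symmetric m X P \<longleftrightarrow>
     (\<forall>t>0. \<forall>f \<in> L2 m \<inter> bounded_borel. \<forall>g \<in> L2 m \<inter> bounded_borel.
        (LINT x|m. semigroup_op X P t f x * g x) = (LINT x|m. f x * semigroup_op X P t g x))"

definition irreducible_process ::
    "'a::topological_space measure \<Rightarrow>
     (real \<Rightarrow> 'w \<Rightarrow> 'a option) \<Rightarrow> ('a option \<Rightarrow> 'w measure) \<Rightarrow> bool" where
  "irreducible_process m X P \<longleftrightarrow>
     (\<forall>A \<in> sets borel.
        (\<forall>f \<in> L2 m \<inter> bounded_borel. \<forall>t>0.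
           AE x in m. semigroup_op X P t (\<lambda>y. indicator A y * f y) x
                        = indicator A x * semigroup_op X P t f x)
        \<longrightarrow> emeasure m A = 0 \<or> emeasure m (- A) = 0)"

definition strong_feller ::
    "(real \<Rightarrow> 'w \<Rightarrow> 'a::topological_space option) \<Rightarrow> ('a option \<Rightarrow> 'w measure) \<Rightarrow> bool" where
  "strong_feller X P \<longleftrightarrow> (\<forall>t>0. semigroup_op X P t ` bounded_borel \<subseteq> bounded_cont)"

definition tight_process ::
    "(real \<Rightarrow> 'w \<Rightarrow> 'a::topological_space option) \<Rightarrow> ('a option \<Rightarrow> 'w measure) \<Rightarrow> bool" where
  "tight_process X P \<longleftrightarrow>
     (\<forall>\<epsilon>>0. \<exists>K. compact K \<and> (SUP x. resolvent_op X P 1 (indicator (- K)) x) \<le> \<epsilon>)"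

definition class_T ::
    "'a::topological_space measure \<Rightarrow>
     (real \<Rightarrow> 'w \<Rightarrow> 'a option) \<Rightarrow> ('a option \<Rightarrow> 'w measure) \<Rightarrow> bool" where
  "class_T m X P \<longleftrightarrow> irreducible_process m X P \<and> strong_feller X P \<and> tight_process X P"


section \<open>Dirichlet form and ground state\<close>

definition approx_form ::
    "'a measure \<Rightarrow> (real \<Rightarrow> 'w \<Rightarrow> 'a option) \<Rightarrow> ('a option \<Rightarrow> 'w measure) \<Rightarrow>
     real \<Rightarrow> ('a \<Rightarrow> real) \<Rightarrow> ('a \<Rightarrow> real) \<Rightarrow> real" where
  "approx_form m X P t u v = (1 / t) * L2_inner m (\<lambda>x. u x - semigroup_op X P t u x) v"

text \<open>The finiteness of the limit is its existence as a real number.\<close>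

definition form_domain ::
    "'a measure \<Rightarrow> (real \<Rightarrow> 'w \<Rightarrow> 'a option) \<Rightarrow> ('a option \<Rightarrow> 'w measure) \<Rightarrow>
     ('a \<Rightarrow> real) set" where
  "form_domain m X P =
     {u \<in> L2 m. \<exists>l::real. ((\<lambda>t. approx_form m X P t u u) \<longlongrightarrow> l) (at_right 0)}"

definition dirichlet_form ::
    "'a measure \<Rightarrow> (real \<Rightarrow> 'w \<Rightarrow> 'a option) \<Rightarrow> ('a option \<Rightarrow> 'w measure) \<Rightarrow>
     ('a \<Rightarrow> real) \<Rightarrow> ('a \<Rightarrow> real) \<Rightarrow> real" where
  "dirichlet_form m X P u v = Lim (at_right 0) (\<lambda>t. approx_form m X P t u v)"

definition spectral_bottom ::
    "'a measure \<Rightarrow> (real \<Rightarrow> 'w \<Rightarrow> 'a option) \<Rightarrow> ('a option \<Rightarrow> 'w measure) \<Rightarrow> real" where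
  "spectral_bottom m X P =
     Inf {dirichlet_form m X P u u | u. u \<in> form_domain m X P \<and> L2_norm m u = 1}"

definition ground_state ::
    "'a measure \<Rightarrow> (real \<Rightarrow> 'w \<Rightarrow> 'a option) \<Rightarrow> ('a option \<Rightarrow> 'w measure) \<Rightarrow>
     ('a \<Rightarrow> real) \<Rightarrow> bool" where
  "ground_state m X P \<phi> \<longleftrightarrow>
     \<phi> \<in> form_domain m X P \<and> L2_norm m \<phi> = 1 \<and>
     dirichlet_form m X P \<phi> \<phi> = spectral_bottom m X P"


section \<open>Quasi-stationary distributions\<close>

definition initial_prob ::
    "('a option \<Rightarrow> 'w measure) \<Rightarrow> 'a measure \<Rightarrow> 'w set \<Rightarrow> real" where
  "initial_prob P \<nu> A = (LINT x|\<nu>. measure (P (Some x)) A)"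

text \<open>A vanishing denominator makes the quotient 0, which the case \<open>B = UNIV\<close> excludes.\<close>

definition quasi_stationary ::
    "'w measure \<Rightarrow> (real \<Rightarrow> 'w \<Rightarrow> 'a::topological_space option) \<Rightarrow>
     ('a option \<Rightarrow> 'w measure) \<Rightarrow> 'a measure \<Rightarrow> bool" where
  "quasi_stationary M X P \<nu> \<longleftrightarrow>
     prob_space \<nu> \<and> sets \<nu> = sets borel \<and>
     (\<forall>t\<ge>0. \<forall>B \<in> sets borel.
        measure \<nu> B = initial_prob P \<nu> {\<omega> \<in> space M. X t \<omega> \<in> Some ` B}
                        / initial_prob P \<nu> {\<omega> \<in> space M. X t \<omega> \<in> range Some})"

definition normalized_measure :: "'a measure \<Rightarrow> ('a \<Rightarrow> real) \<Rightarrow> 'a measure" where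
  "normalized_measure m \<phi> = density m (\<lambda>x. ennreal (\<phi> x / (LINT y|m. \<phi> y)))"

end

theory Submission
  imports Defs "HOL-Real_Asymp.Real_Asymp"
begin

text \<open>
  Write \<open>p\<^sub>t\<close> for the transition semigroup on \<open>E\<close> and \<open>c\<close> for the bottom of the spectrum. The proof rests on
  three facts about the ground state \<open>\<phi>\<close>.

  It is an eigenfunction: \<open>p\<^sub>t \<phi> = exp (- c t) \<phi>\<close> at every point (\<open>minimizer_is_eigenfunction\<close>). The
  correlation \<open>(\<phi>, p\<^sub>t \<phi>)\<close> decays at least like \<open>exp (- c t)\<close> because the form is at least \<open>c\<close> along
  the orbit of \<open>\<phi>\<close>, and at most like that because it starts with slope \<open>- c\<close> and its square at time \<open>t\<close> is
  at most its value at time \<open>2 t\<close>; equality pins down \<open>p\<^sub>t \<phi>\<close> almost everywhere, and the strong Feller property everywhere.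

  It is integrable (\<open>eigenfunction_integrable\<close>). By tightness the resolvent is small off a compact set
  \<open>K\<close>, uniformly; by symmetry it is then a contraction in \<open>L\<^sup>1\<close> there, so the part of \<open>\<phi>\<close> off \<open>K\<close> is
  dominated by the part on \<open>K\<close>, which is bounded on a set of finite measure. Hence the normalized measure
  is a probability measure, and symmetry together with the eigenvalue equation shows that it is
  quasi-stationary.

  Every quasi-stationary distribution is a multiple of it (\<open>quasi_stationary_unique\<close>). If \<open>\<nu>\<close> is
  quasi-stationary, then \<open>\<nu> p\<^sub>t\<close> is a multiple of \<open>\<nu>\<close>; testing against \<open>\<phi>\<close>, which is positive and bounded, forces the
  factor to be \<open>exp (- c t)\<close>. The strong Feller property gives \<open>\<nu>\<close> a density \<open>h\<close>. Comparing \<open>h\<close> with the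
  normalized ground state \<open>\<psi>\<close> through their minimum shows that \<open>{h < \<psi>}\<close> is an invariant set. By
  irreducibility one of the two densities dominates the other, so they coincide. The
  argument with the minimum works with \<open>h\<close> merely integrable, where Hilbert space methods would ask
  for \<open>h\<close> in \<open>L\<^sup>2\<close>.
\<close>

section \<open>The transition kernels of a process with lifetime\<close>

lemma space_cemetery_borel [simp]: "space cemetery_borel = UNIV"
  by (simp add: cemetery_borel_def)

lemma measurable_Some_cemetery [measurable]: "Some \<in> borel \<rightarrow>\<^sub>M cemetery_borel"
  unfolding cemetery_borel_def
proof (rule measurable_measure_of)
  fix U :: "'a option set"
  assume "U \<in> {U. openin (Alexandroff_compactification euclidean) U}"
  then have "open (Some -` U)"
    by (auto simp: openin_Alexandroff_compactification vimage_def image_iff open_closed Compl_eq)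
  then show "Some -` U \<inter> space borel \<in> sets borel" by simp
qed auto

text \<open>\<open>E\<close> sits in its one-point compactification as an open subspace, so Borel sets of \<open>E\<close> stay
  Borel after the cemetery point is added.\<close>

lemma image_Some_in_cemetery_borel:
  assumes "B \<in> sets (borel :: 'a::topological_space measure)"
  shows "Some ` B \<in> sets cemetery_borel"
proof -
  have op: "Some ` U \<in> sets cemetery_borel" if "open U" for U :: "'a set"
    unfolding cemetery_borel_def
    using that by (intro in_measure_of) (auto simp: openin_Alexandroff_compactification)
  have "B \<in> sigma_sets UNIV {S. open S}"
    using assms by (simp add: borel_def)
  then show ?thesis
  proof induction
    case (Compl a)
    have "Some ` (UNIV - a) = range Some - Some ` a" by auto
    then show ?case using op[of UNIV] Compl by auto
  next
    case (Union a)
    then show ?case by (auto simp: image_UN)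
  qed (use op in auto)
qed

lemma measurable_case_option_cemetery:
  assumes f: "f \<in> (borel :: 'a::topological_space measure) \<rightarrow>\<^sub>M N" and c: "c \<in> space N"
  shows "case_option c f \<in> cemetery_borel \<rightarrow>\<^sub>M N"
proof (rule measurableI)
  fix z :: "'a option" show "case_option c f z \<in> space N"
    using c measurable_space[OF f] by (cases z) auto
next
  fix S assume S: "S \<in> sets N"
  have 1: "Some ` (f -` S) \<in> sets cemetery_borel"
    using measurable_sets[OF f S] by (intro image_Some_in_cemetery_borel) auto
  have "UNIV - range Some \<in> sets (cemetery_borel :: 'a option measure)"
    using image_Some_in_cemetery_borel[of UNIV] sets.compl_sets by fastforce
  then have 2: "{None} \<in> sets (cemetery_borel :: 'a option measure)"
    by (metis UNIV_option_conv insert_Diff_if Diff_cancel notin_range_Some rangeE option.distinct(1))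
  have "case_option c f -` S \<inter> space cemetery_borel = Some ` (f -` S) \<union> (if c \<in> S then {None} else {})"
    by (auto split: option.splits)
  then show "case_option c f -` S \<inter> space cemetery_borel \<in> sets cemetery_borel"
    using sets.Un[OF 1 2] 1 by auto
qed

lemma extend0_eq_case_option: "extend0 f = case_option 0 f"
  by (auto simp: extend0_def fun_eq_iff)

context markov_process
begin

lemma space_P [simp]: "space (P z) = space M"
  using sets_P sets_eq_imp_space_eq by blast

lemma measurable_X_at: "0 \<le> t \<Longrightarrow> X t \<in> M \<rightarrow>\<^sub>M cemetery_borel"
  using measurable_Pair2[OF measurable_X, of t] by (simp add: space_restrict_space)

lemma measurable_X_at_P: "0 \<le> t \<Longrightarrow> X t \<in> P z \<rightarrow>\<^sub>M cemetery_borel"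
  using measurable_X_at measurable_cong_sets[OF sets_P refl] by blast

text \<open>The transition function of the process killed at its lifetime, as a measure on \<open>E\<close> itself:
  the law of the current position restricted to the event of being alive. It has mass at most one.\<close>

definition transition :: "real \<Rightarrow> 'a \<Rightarrow> 'a measure" where
  "transition t x = distr (restrict_space (P (Some x)) {\<omega> \<in> space M. X t \<omega> \<noteq> None}) borel (\<lambda>\<omega>. the (X t \<omega>))"

lemma sets_transition_kernel [simp, measurable_cong]: "sets (transition t x) = sets borel"
  and space_transition_kernel [simp]: "space (transition t x) = UNIV"
  by (simp_all add: transition_def)

lemma alive_set: "0 \<le> t \<Longrightarrow> {\<omega> \<in> space M. X t \<omega> \<noteq> None} \<in> sets M"
proof -
  assume "0 \<le> t"
  have "X t -` (range Some) \<inter> space M \<in> sets M"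
    by (rule measurable_sets[OF measurable_X_at[OF \<open>0 \<le> t\<close>]]) (use image_Some_in_cemetery_borel[of UNIV] in simp)
  also have "X t -` (range Some) \<inter> space M = {\<omega> \<in> space M. X t \<omega> \<noteq> None}"
    by auto
  finally show ?thesis .
qed

lemma measurable_the_X:
  assumes "0 \<le> t"
  shows "(\<lambda>\<omega>. the (X t \<omega>)) \<in> restrict_space (P z) {\<omega> \<in> space M. X t \<omega> \<noteq> None} \<rightarrow>\<^sub>M borel"
proof -
  have "(\<lambda>\<omega>. case_option undefined (\<lambda>x. x) (X t \<omega>)) \<in> P z \<rightarrow>\<^sub>M borel"
    by (rule measurable_compose[OF measurable_X_at_P[OF assms] measurable_case_option_cemetery]) auto
  then have "(\<lambda>\<omega>. case_option undefined (\<lambda>x. x) (X t \<omega>)) \<in> restrict_space (P z) {\<omega> \<in> space M. X t \<omega> \<noteq> None} \<rightarrow>\<^sub>M borel"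
    by (rule measurable_restrict_space1)
  then show ?thesis
    by (rule measurable_cong[THEN iffD1, rotated]) (auto simp: space_restrict_space)
qed

lemma nn_integral_transition_kernel:
  assumes t: "0 \<le> t" and [measurable]: "f \<in> borel_measurable borel"
  shows "(\<integral>\<^sup>+y. f y \<partial>transition t x) = (\<integral>\<^sup>+\<omega>. case_option 0 f (X t \<omega>) \<partial>P (Some x))"
proof -
  have "(\<integral>\<^sup>+y. f y \<partial>transition t x)
      = (\<integral>\<^sup>+\<omega>. f (the (X t \<omega>)) \<partial>restrict_space (P (Some x)) {\<omega> \<in> space M. X t \<omega> \<noteq> None})"
    unfolding transition_def by (intro nn_integral_distr measurable_the_X t) simp
  also have "\<dots> = (\<integral>\<^sup>+\<omega>. f (the (X t \<omega>)) * indicator {\<omega> \<in> space M. X t \<omega> \<noteq> None} \<omega> \<partial>P (Some x))"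
    by (rule nn_integral_restrict_space) (use alive_set[OF t] sets_P in auto)
  also have "\<dots> = (\<integral>\<^sup>+\<omega>. case_option 0 f (X t \<omega>) \<partial>P (Some x))"
    by (intro nn_integral_cong) (auto simp: indicator_def split: option.splits)
  finally show ?thesis .
qed

lemma integral_transition_kernel:
  assumes t: "0 \<le> t" and [measurable]: "f \<in> borel_measurable borel"
  shows "(LINT y|transition t x. f y) = semigroup_op X P t f x"
proof -
  have "(LINT y|transition t x. f y)
      = (LINT \<omega>|restrict_space (P (Some x)) {\<omega> \<in> space M. X t \<omega> \<noteq> None}. f (the (X t \<omega>)))"
    unfolding transition_def by (intro integral_distr measurable_the_X t) simp
  also have "\<dots> = (LINT \<omega>|P (Some x). indicator {\<omega> \<in> space M. X t \<omega> \<noteq> None} \<omega> *\<^sub>R f (the (X t \<omega>)))"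
    by (rule integral_restrict_space) (use alive_set[OF t] sets_P in auto)
  also have "\<dots> = semigroup_op X P t f x"
    unfolding semigroup_op_def
    by (intro Bochner_Integration.integral_cong) (auto simp: extend0_def indicator_def split: option.splits)
  finally show ?thesis .
qed

lemma emeasure_transition_kernel:
  assumes t: "0 \<le> t" and [measurable]: "B \<in> sets borel"
  shows "emeasure (transition t x) B = emeasure (P (Some x)) {\<omega> \<in> space M. X t \<omega> \<in> Some ` B}"
proof -
  have S: "{\<omega> \<in> space M. X t \<omega> \<in> Some ` B} \<in> sets (P (Some x))"
    using measurable_sets[OF measurable_X_at_P[OF t] image_Some_in_cemetery_borel[of B]]
    by (simp add: vimage_def Int_def conj_commute)
  have "emeasure (transition t x) B = (\<integral>\<^sup>+y. indicator B y \<partial>transition t x)" by simp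
  also have "\<dots> = (\<integral>\<^sup>+\<omega>. indicator {\<omega> \<in> space M. X t \<omega> \<in> Some ` B} \<omega> \<partial>P (Some x))"
    by (subst nn_integral_transition_kernel[OF t], simp, intro nn_integral_cong)
       (auto simp: indicator_def image_iff split: option.splits)
  finally show ?thesis using S by simp
qed

lemma subprob_space_transition_kernel: "0 \<le> t \<Longrightarrow> subprob_space (transition t x)"
  using prob_space.emeasure_le_1[OF prob_space_P]
  by (intro subprob_spaceI) (simp_all add: emeasure_transition_kernel)

lemma measurable_transition_kernel: "0 \<le> t \<Longrightarrow> transition t \<in> borel \<rightarrow>\<^sub>M subprob_algebra borel"
proof (rule measurable_subprob_algebra)
  fix B :: "'a set" assume t: "0 \<le> t" and B: "B \<in> sets borel"
  have "(\<lambda>x. ennreal (measure (P (Some x)) {\<omega> \<in> space M. X t \<omega> \<in> Some ` B})) \<in> borel_measurable borel"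
    using measurable_compose[OF measurable_Some_cemetery measurable_transition[OF t image_Some_in_cemetery_borel[OF B]]]
    by measurable
  then show "(\<lambda>x. emeasure (transition t x) B) \<in> borel_measurable borel"
    by (simp add: emeasure_transition_kernel[OF t B] finite_measure.emeasure_eq_measure prob_space.finite_measure prob_space_P)
qed (auto intro: subprob_space_transition_kernel)

lemma transition_0: "transition 0 x = return borel x"
proof (rule measure_eqI)
  fix B assume "B \<in> sets (transition 0 x)"
  then have [measurable]: "B \<in> sets borel" by simp
  have "emeasure (transition 0 x) B = (\<integral>\<^sup>+\<omega>. case_option 0 (indicator B) (X 0 \<omega>) \<partial>P (Some x))"
    by (subst nn_integral_transition_kernel[symmetric]) auto
  also have "\<dots> = (\<integral>\<^sup>+\<omega>. indicator B x \<partial>P (Some x))"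
    by (intro nn_integral_cong_AE) (use normal[of "Some x"] in \<open>auto elim: eventually_mono\<close>)
  also have "\<dots> = indicator B x"
    using prob_space.emeasure_space_1[OF prob_space_P] by simp
  finally show "emeasure (transition 0 x) B = emeasure (return borel x) B" by simp
qed simp

lemma cemetery_absorbing:
  "\<omega> \<in> space M \<Longrightarrow> 0 \<le> s \<Longrightarrow> s \<le> t \<Longrightarrow> X s \<omega> = None \<Longrightarrow> X t \<omega> = None"
  using lifetime[of \<omega> s] lifetime[of \<omega> t] by (meson ereal_less_eq(3) order.trans)

text \<open>Started at the cemetery the process is there at time 0, hence its lifetime has already ended and
  it remains there.\<close>

lemma dead_stays_dead:
  assumes t: "0 \<le> t" and B: "B \<in> sets borel"
  shows "measure (P None) {\<omega> \<in> space M. X t \<omega> \<in> Some ` B} = 0"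
proof -
  have "AE \<omega> in P None. \<omega> \<notin> {\<omega> \<in> space M. X t \<omega> \<in> Some ` B}"
    using normal[of None] by eventually_elim (use cemetery_absorbing[of _ 0 t] t in auto)
  then have "emeasure (P None) {\<omega> \<in> space M. X t \<omega> \<in> Some ` B} = 0"
    by (rule AE_iff_measurable[THEN iffD1, rotated 2])
       (use measurable_sets[OF measurable_X_at_P[OF t] image_Some_in_cemetery_borel[OF B], of None]
         in \<open>auto simp: vimage_def Int_def conj_commute\<close>)
  then show ?thesis by (simp add: measure_def)
qed

lemma subalgebra_natural_filtration: "subalgebra (P z) (natural_filtration M X s)"
proof -
  have "X r -` B \<inter> space M \<in> sets M" if "0 \<le> r" "B \<in> sets cemetery_borel" for r B
    using measurable_sets[OF measurable_X_at] that by blast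
  then have "sigma_sets (space M) {X r -` B \<inter> space M |r B. 0 \<le> r \<and> r \<le> s \<and> B \<in> sets cemetery_borel} \<subseteq> sets M"
    by (intro sets.sigma_sets_subset) blast
  moreover have "{X r -` B \<inter> space M |r B. 0 \<le> r \<and> r \<le> s \<and> B \<in> sets cemetery_borel} \<subseteq> Pow (space M)"
    by blast
  ultimately show ?thesis
    by (simp add: subalgebra_def natural_filtration_def sets_P)
qed

text \<open>Chapman--Kolmogorov. Integrating the Markov property removes the conditional expectation, and the
  paths that are already dead at time \<open>s\<close> contribute nothing, so the intermediate integral runs over
  \<open>E\<close> only.\<close>

lemma emeasure_transition_kernel_add:
  assumes s: "0 \<le> s" and t: "0 \<le> t" and B: "B \<in> sets borel"
  shows "emeasure (transition (s + t) x) B = (\<integral>\<^sup>+y. emeasure (transition t y) B \<partial>transition s x)"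
proof -
  let ?P = "P (Some x)" and ?F = "natural_filtration M X s" and ?S = "Some ` B"
  define g where "g z = measure (P z) {\<omega> \<in> space M. X t \<omega> \<in> ?S}" for z
  interpret p: prob_space ?P by (rule prob_space_P)
  interpret finite_measure_subalgebra ?P ?F
    by unfold_locales (rule subalgebra_natural_filtration)
  have S [measurable]: "?S \<in> sets cemetery_borel"
    by (rule image_Some_in_cemetery_borel[OF B])
  have [measurable]: "X s \<in> ?P \<rightarrow>\<^sub>M cemetery_borel" "X (s + t) \<in> ?P \<rightarrow>\<^sub>M cemetery_borel"
    using measurable_X_at_P s t by auto
  have [measurable]: "g \<in> borel_measurable cemetery_borel"
    unfolding g_def by (rule measurable_transition[OF t S])
  have int_g: "integrable ?P (\<lambda>\<omega>. g (X s \<omega>))"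
  proof (rule p.integrable_const_bound[of _ 1])
    show "AE \<omega> in ?P. norm (g (X s \<omega>)) \<le> 1"
      by (auto simp: g_def prob_space.prob_le_1[OF prob_space_P])
  qed simp
  have "integrable ?P (\<lambda>\<omega>. indicator ?S (X (s + t) \<omega>) :: real)"
    by (rule p.integrable_const_bound[of _ 1]) auto
  then have "(LINT \<omega>|?P. indicator ?S (X (s + t) \<omega>))
      = (LINT \<omega>|?P. real_cond_exp ?P ?F (\<lambda>\<omega>'. indicator ?S (X (s + t) \<omega>')) \<omega>)"
    by (rule real_cond_exp_int(2)[symmetric])
  also have "\<dots> = (LINT \<omega>|?P. g (X s \<omega>))"
    by (rule integral_cong_AE) (use markov_property[OF s t S, of "Some x"] in \<open>simp_all flip: g_def\<close>)
  finally have eq: "(LINT \<omega>|?P. indicator ?S (X (s + t) \<omega>)) = (LINT \<omega>|?P. g (X s \<omega>))" .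
  have "emeasure (transition (s + t) x) B = emeasure ?P {\<omega> \<in> space M. X (s + t) \<omega> \<in> ?S}"
    using s t B by (simp add: emeasure_transition_kernel)
  also have "\<dots> = ennreal (LINT \<omega>|?P. indicator {\<omega> \<in> space M. X (s + t) \<omega> \<in> ?S} \<omega>)"
    by (simp add: p.emeasure_eq_measure Int_def conj_commute)
  also have "(LINT \<omega>|?P. indicator {\<omega> \<in> space M. X (s + t) \<omega> \<in> ?S} \<omega>) = (LINT \<omega>|?P. indicator ?S (X (s + t) \<omega>) :: real)"
    by (intro Bochner_Integration.integral_cong) (auto simp: indicator_def)
  also have "ennreal \<dots> = (\<integral>\<^sup>+\<omega>. ennreal (g (X s \<omega>)) \<partial>?P)"
    unfolding eq by (rule nn_integral_eq_integral[symmetric, OF int_g]) (auto simp: g_def)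
  also have "\<dots> = (\<integral>\<^sup>+\<omega>. case_option 0 (\<lambda>y. emeasure (transition t y) B) (X s \<omega>) \<partial>?P)"
    by (intro nn_integral_cong)
       (auto simp: g_def dead_stays_dead[OF t B] emeasure_transition_kernel[OF t B] prob_space.finite_measure
              prob_space_P finite_measure.emeasure_eq_measure split: option.splits)
  also have "\<dots> = (\<integral>\<^sup>+y. emeasure (transition t y) B \<partial>transition s x)"
    by (rule nn_integral_transition_kernel[symmetric, OF s measurable_emeasure_kernel[OF measurable_transition_kernel[OF t] B]])
  finally show ?thesis .
qed

text \<open>Fubini on the sample space, from joint measurability of the paths in time and chance.\<close>

lemma measurable_transition_kernel_time:
  assumes B: "B \<in> sets borel"
  shows "(\<lambda>t. emeasure (transition t x) B) \<in> borel_measurable (restrict_space borel {0..})"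
proof -
  interpret prob_space "P (Some x)" by (rule prob_space_P)
  have [measurable]: "(\<lambda>(t, \<omega>). X t \<omega>) \<in> restrict_space borel {0..} \<Otimes>\<^sub>M P (Some x) \<rightarrow>\<^sub>M cemetery_borel"
    using measurable_X measurable_cong_sets[OF sets_pair_measure_cong[OF refl sets_P] refl] by blast
  have [measurable]: "case_option 0 (indicator B :: 'a \<Rightarrow> ennreal) \<in> borel_measurable cemetery_borel"
    using B by (intro measurable_case_option_cemetery) auto
  have "(\<lambda>t. \<integral>\<^sup>+\<omega>. case_option 0 (indicator B) (X t \<omega>) \<partial>P (Some x)) \<in> borel_measurable (restrict_space borel {0..})"
    by measurable
  then show ?thesis
    by (rule measurable_cong[THEN iffD1, rotated])
       (use B in \<open>auto simp: space_restrict_space nn_integral_transition_kernel[symmetric]\<close>)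
qed

end

section \<open>A function that starts with the least possible slope is exponential\<close>

lemma dyadic_convexity:
  fixes F :: "real \<Rightarrow> real"
  assumes mid: "\<And>s t. a \<le> s \<Longrightarrow> a \<le> t \<Longrightarrow> 2 * F ((s + t) / 2) \<le> F s + F t"
    and x: "a \<le> x" "x \<le> y" and k: "k \<le> 2 ^ n"
  shows "F (x + real k / 2 ^ n * (y - x)) \<le> F x + real k / 2 ^ n * (F y - F x)"
  using k
proof (induction n arbitrary: k)
  case 0
  then have "k = 0 \<or> k = 1" by auto
  then show ?case by auto
next
  case (Suc n)
  show ?case
  proof (cases "even k")
    case True
    then obtain j where j: "k = 2 * j" by blast
    with Suc show ?thesis by auto
  next
    case False
    then obtain j where j: "k = 2 * j + 1" using oddE by blast
    with Suc.prems have le: "j \<le> 2 ^ n" "j + 1 \<le> 2 ^ n" by auto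
    let ?z = "\<lambda>i. x + real i / 2 ^ n * (y - x)"
    have z: "x + real k / 2 ^ Suc n * (y - x) = (?z j + ?z (j + 1)) / 2"
      by (simp add: j field_simps)
    have "a \<le> ?z i" for i using x by (auto intro!: order_trans[of a x] mult_nonneg_nonneg)
    from mid[OF this this, of j "j + 1"] Suc.IH[OF le(1)] Suc.IH[OF le(2)]
    have "2 * F (x + real k / 2 ^ Suc n * (y - x))
      \<le> (F x + real j / 2 ^ n * (F y - F x)) + (F x + real (j + 1) / 2 ^ n * (F y - F x))"
      unfolding z by linarith
    also have "\<dots> = 2 * (F x + real k / 2 ^ Suc n * (F y - F x))"
      by (simp add: j field_simps)
    finally show ?thesis by (rule mult_left_le_imp_le) simp
  qed
qed

text \<open>Midpoint convexity gives the convexity inequality at dyadic weights. For a general weight \<open>t\<close>,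
  approximate \<open>t\<close> by dyadics from below; the corresponding points lie to the left, where a nonincreasing
  function is larger, so the inequality survives in the limit.\<close>

lemma midpoint_convex_antimono_imp_convex_on:
  fixes F :: "real \<Rightarrow> real"
  assumes mid: "\<And>s t. a \<le> s \<Longrightarrow> a \<le> t \<Longrightarrow> 2 * F ((s + t) / 2) \<le> F s + F t"
    and anti: "\<And>s t. a \<le> s \<Longrightarrow> s \<le> t \<Longrightarrow> F t \<le> F s"
  shows "convex_on {a..} F"
proof (rule convex_on_linorderI)
  fix t x y :: real
  assume t: "0 < t" "t < 1" and xy: "x \<in> {a..}" "y \<in> {a..}" "x < y"
  have le: "F (x + t * (y - x)) \<le> F x + (t - (1/2) ^ n) * (F y - F x)" for n
  proof -
    define k where "k = nat \<lfloor>2 ^ n * t\<rfloor>"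
    have k1: "real k \<le> 2 ^ n * t" and k2: "2 ^ n * t < real k + 1"
      using t by (auto simp: k_def)
    have "2 ^ n * t \<le> 2 ^ n * 1" using t by (intro mult_left_mono) auto
    with k1 have "real k \<le> 2 ^ n" by linarith
    then have k: "k \<le> 2 ^ n" by simp
    have "t \<le> (real k + 1) / 2 ^ n"
      using k2 by (simp add: pos_le_divide_eq mult.commute)
    then have kt: "real k / 2 ^ n \<le> t" "t - (1/2) ^ n \<le> real k / 2 ^ n"
      using k1 by (simp_all add: add_divide_distrib power_one_over pos_divide_le_eq mult.commute)
    have "F (x + t * (y - x)) \<le> F (x + real k / 2 ^ n * (y - x))"
      using xy kt by (intro anti add_left_mono mult_right_mono) (auto intro!: order_trans[of a x] mult_nonneg_nonneg)
    also have "\<dots> \<le> F x + real k / 2 ^ n * (F y - F x)"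
      by (rule dyadic_convexity[of a, OF mid _ _ k]) (use xy in auto)
    also have "\<dots> \<le> F x + (t - (1/2) ^ n) * (F y - F x)"
      using kt anti[of x y] xy by (intro add_left_mono mult_right_mono_neg) auto
    finally show ?thesis .
  qed
  have "(\<lambda>n. F x + (t - (1/2) ^ n) * (F y - F x)) \<longlonglongrightarrow> F x + (t - 0) * (F y - F x)"
    by (intro tendsto_intros LIMSEQ_power_zero) auto
  from LIMSEQ_le_const[OF this] le
  have "F (x + t * (y - x)) \<le> F x + t * (F y - F x)" by auto
  then show "F ((1 - t) *\<^sub>R x + t *\<^sub>R y) \<le> (1 - t) * F x + t * F y"
    by (simp add: algebra_simps)
qed simp

text \<open>Difference quotients of a convex function are monotone, so the right derivative exists at interior
  points and is controlled by every chord to the left.\<close>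

lemma convex_on_right_slope:
  fixes F :: "real \<Rightarrow> real"
  assumes cvx: "convex_on {a..} F" and as: "a < s"
  obtains l where "((\<lambda>t. (F s - F (s + t)) / t) \<longlongrightarrow> l) (at_right 0)"
    and "\<And>r. a \<le> r \<Longrightarrow> r < s \<Longrightarrow> l \<le> (F r - F s) / (s - r)"
proof -
  define q where "q t = (F s - F (s + t)) / t" for t
  have q_le: "q t \<le> (F r - F s) / (s - r)" if "a \<le> r" "r < s" "0 < t" for r t
  proof -
    have "(F r - F s) / (r - s) \<le> (F s - F (s + t)) / (s - (s + t))"
      using convex_on_slope_le[OF cvx, of r "s + t" s] that as by force
    then show ?thesis using that by (simp add: q_def field_simps)
  qed
  have q_anti: "q u \<le> q t" if "0 < t" "t \<le> u" for t u
  proof (cases "t = u")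
    case False
    then have "(F s - F (s + t)) / (s - (s + t)) \<le> (F s - F (s + u)) / (s - (s + u))"
      using convex_on_slope_le(1)[OF cvx, of s "s + u" "s + t"] that as by force
    then show ?thesis using that by (simp add: q_def field_simps)
  qed simp
  have bdd: "bdd_above (q ` {0<..})"
    using q_le[of a] as by (intro bdd_aboveI2[of _ _ "(F a - F s) / (s - a)"]) auto
  define l where "l = (SUP t\<in>{0<..}. q t)"
  have "(q \<longlongrightarrow> l) (at_right 0)"
  proof (rule increasing_tendsto)
    show "\<forall>\<^sub>F t in at_right 0. q t \<le> l"
      using bdd by (auto simp: eventually_at_filter l_def intro!: cSUP_upper always_eventually)
  next
    fix x assume "x < l"
    then obtain t where t: "0 < t" "x < q t"
      unfolding l_def using less_cSUP_iff[OF _ bdd] by auto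
    have "\<forall>\<^sub>F u in at_right 0. u < t" using t(1) by (auto simp: eventually_at_right_field)
    then show "\<forall>\<^sub>F u in at_right 0. x < q u"
      using eventually_at_right_less[of 0]
      by eventually_elim (use q_anti t in \<open>meson less_le_trans less_imp_le\<close>)
  qed
  moreover have "l \<le> (F r - F s) / (s - r)" if "a \<le> r" "r < s" for r
    unfolding l_def by (rule cSUP_least) (use q_le that in auto)
  ultimately show ?thesis using that unfolding q_def by blast
qed

text \<open>The one-dimensional core of the variational argument. It will be applied to
  \<open>F t = (\<phi>, p\<^sub>t \<phi>)\<close> with \<open>\<phi>\<close> a minimizer of the Dirichlet form. The lower bound
  \<open>exp (- c t) \<le> F t\<close> comes from the initial slope alone: it holds approximately for small times and
  repeated squaring carries it to time \<open>t\<close>. The upper bound comes from minimality: at every \<open>s\<close> the downward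
  slope is at least \<open>c * F s\<close>, which by convexity gives \<open>F (r + h) * (1 + c h) \<le> F r\<close>; iterate
  over \<open>n\<close> steps of length \<open>t / n\<close>.\<close>

lemma exponential_from_minimal_initial_slope:
  fixes F :: "real \<Rightarrow> real"
  assumes mid: "\<And>s t. 0 \<le> s \<Longrightarrow> 0 \<le> t \<Longrightarrow> 2 * F ((s + t) / 2) \<le> F s + F t"
    and anti: "\<And>s t. 0 \<le> s \<Longrightarrow> s \<le> t \<Longrightarrow> F t \<le> F s"
    and nonneg: "\<And>t. 0 \<le> t \<Longrightarrow> 0 \<le> F t"
    and square: "\<And>t. 0 \<le> t \<Longrightarrow> (F t)\<^sup>2 \<le> F (2 * t)"
    and init: "((\<lambda>t. (1 - F t) / t) \<longlongrightarrow> c) (at_right 0)"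
    and F0: "F 0 = 1"
    and slope: "\<And>s l. 0 \<le> s \<Longrightarrow> ((\<lambda>t. (F s - F (s + t)) / t) \<longlongrightarrow> l) (at_right 0) \<Longrightarrow> c * F s \<le> l"
    and t: "0 \<le> t"
  shows "0 \<le> c" "F t = exp (- c * t)"
proof -
  have cvx: "convex_on {0..} F"
    by (rule midpoint_convex_antimono_imp_convex_on) (use mid anti in auto)
  show c: "0 \<le> c"
    by (rule tendsto_lowerbound[OF init])
       (use anti[of 0] F0 in \<open>auto simp: eventually_at_filter intro!: always_eventually divide_nonneg_pos\<close>)
  have step: "F (r + h) * (1 + c * h) \<le> F r" if rh: "0 \<le> r" "0 < h" for r h
  proof -
    obtain l where l: "((\<lambda>t. (F (r + h) - F (r + h + t)) / t) \<longlongrightarrow> l) (at_right 0)"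
      "\<And>r'. 0 \<le> r' \<Longrightarrow> r' < r + h \<Longrightarrow> l \<le> (F r' - F (r + h)) / (r + h - r')"
    proof -
      have "0 < r + h" using rh by simp
      from convex_on_right_slope[OF cvx this] show thesis using that by blast
    qed
    have "c * F (r + h) \<le> (F r - F (r + h)) / h"
      using slope[OF _ l(1)] l(2)[of r] that by simp
    then show ?thesis using that by (simp add: field_simps)
  qed
  have iter: "F (real n * h) * (1 + c * h) ^ n \<le> 1" if "0 < h" for n h
  proof (induction n)
    case (Suc n)
    have "F (real (Suc n) * h) * (1 + c * h) ^ Suc n = (F (real n * h + h) * (1 + c * h)) * (1 + c * h) ^ n"
      by (simp add: algebra_simps)
    also have "\<dots> \<le> F (real n * h) * (1 + c * h) ^ n"
      using step[of "real n * h" h] that c by (intro mult_right_mono) auto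
    finally show ?case using Suc by simp
  qed (simp add: F0)
  show "F t = exp (- c * t)"
  proof (cases "t = 0")
    case False
    with t have t: "0 < t" by simp
    have "(\<lambda>n. F t * (1 + (c * t) / real n) ^ n) \<longlonglongrightarrow> F t * exp (c * t)"
      by (intro tendsto_mult tendsto_const tendsto_exp_limit_sequentially)
    then have "F t * exp (c * t) \<le> 1"
    proof (rule LIMSEQ_le_const2)
      have "F t * (1 + c * t / real n) ^ n \<le> 1" if "n \<noteq> 0" for n
        using iter[of "t / real n" n] that t by simp
      then show "\<exists>N. \<forall>n\<ge>N. F t * (1 + c * t / real n) ^ n \<le> 1"
        by (intro exI[of _ 1]) auto
    qed
    then have upper: "F t \<le> exp (- c * t)"
      by (simp add: exp_minus field_simps)
    \<comment> \<open>A rate \<open>d\<close> slightly larger than \<open>c\<close> leaves room for the error term of the initial slope.\<close>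
    have lower: "exp (- d * t) \<le> F t" if d: "c < d" for d
    proof -
      have "((\<lambda>h. (1 - exp (- d * h)) / h) \<longlongrightarrow> d) (at_right 0)"
        by real_asymp
      from order_tendstoD(1)[OF tendsto_diff[OF this init], of 0] d
      have "\<forall>\<^sub>F h in at_right 0. 0 < (1 - exp (- d * h)) / h - (1 - F h) / h" by simp
      then have ev: "\<forall>\<^sub>F h in at_right 0. exp (- d * h) \<le> F h"
        using eventually_at_right_less[of 0]
        by eventually_elim (auto simp: field_simps)
      have "filterlim (\<lambda>n. t / 2 ^ n) (at_right 0) sequentially"
        using t by real_asymp
      from eventually_compose_filterlim[OF ev this]
      obtain n where n: "exp (- d * (t / 2 ^ n)) \<le> F (t / 2 ^ n)"
        by (auto simp: eventually_sequentially)
      have "exp (- d * (t / 2 ^ n * 2 ^ k)) \<le> F (t / 2 ^ n * 2 ^ k)" for k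
      proof (induction k)
        case (Suc k)
        have "exp (- d * (t / 2 ^ n * 2 ^ Suc k)) = (exp (- d * (t / 2 ^ n * 2 ^ k)))\<^sup>2"
          by (simp add: exp_double[symmetric] algebra_simps)
        also have "\<dots> \<le> (F (t / 2 ^ n * 2 ^ k))\<^sup>2"
          using Suc by (intro power_mono) auto
        also have "\<dots> \<le> F (t / 2 ^ n * 2 ^ Suc k)"
          using square[of "t / 2 ^ n * 2 ^ k"] t by (simp add: mult_ac)
        finally show ?case .
      qed (use n in simp)
      from this[of n] show ?thesis by simp
    qed
    have "((\<lambda>d. exp (- d * t)) \<longlongrightarrow> exp (- c * t)) (at_right c)"
      by (intro tendsto_intros)
    then have "exp (- c * t) \<le> F t"
      by (rule tendsto_upperbound) (use lower in \<open>auto simp: eventually_at_filter intro!: always_eventually\<close>)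
    with upper show ?thesis by simp
  qed (simp add: F0)
qed

section \<open>Symmetric strong Feller semigroups\<close>

lemma L2_integrable_mult:
  assumes "u \<in> L2 m" "v \<in> L2 m"
  shows "integrable m (\<lambda>x. u x * v x)"
proof (rule Bochner_Integration.integrable_bound)
  show "integrable m (\<lambda>x. (u x)\<^sup>2 + (v x)\<^sup>2)"
    using assms by (auto simp: L2_def)
  show "AE x in m. norm (u x * v x) \<le> norm ((u x)\<^sup>2 + (v x)\<^sup>2)"
  proof (rule AE_I2)
    fix x
    have "0 \<le> (\<bar>u x\<bar> - \<bar>v x\<bar>)\<^sup>2" by simp
    then have "2 * (\<bar>u x\<bar> * \<bar>v x\<bar>) \<le> (u x)\<^sup>2 + (v x)\<^sup>2"
      by (simp add: power2_diff)
    moreover have "0 \<le> \<bar>u x\<bar> * \<bar>v x\<bar>" by simp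
    ultimately show "norm (u x * v x) \<le> norm ((u x)\<^sup>2 + (v x)\<^sup>2)"
      unfolding real_norm_def abs_mult by linarith
  qed
qed (use assms in \<open>auto simp: L2_def\<close>)

lemma L2_cmult: "u \<in> L2 m \<Longrightarrow> (\<lambda>x. c * u x) \<in> L2 m"
  by (auto simp: L2_def power_mult_distrib)

text \<open>The Cauchy--Schwarz inequality against the constant one. When \<open>u\<^sup>2\<close> is not integrable the bound is
  trivial, so it also covers functions whose integral is only nominally defined.\<close>

lemma (in subprob_space) square_integral_le:
  assumes [measurable]: "u \<in> borel_measurable M"
  shows "ennreal ((LINT y|M. u y)\<^sup>2) \<le> (\<integral>\<^sup>+y. ennreal ((u y)\<^sup>2) \<partial>M)"
proof (cases "integrable M (\<lambda>y. (u y)\<^sup>2)")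
  case True
  define a where "a = (LINT y|M. u y)"
  have u: "integrable M u"
    using square_integrable_imp_integrable[OF _ True] by simp
  have "0 \<le> (LINT y|M. (u y - a)\<^sup>2)" by simp
  also have "\<dots> = (LINT y|M. (u y)\<^sup>2 - 2 * a * u y + a\<^sup>2)"
    by (intro Bochner_Integration.integral_cong) (auto simp: power2_diff)
  also have "\<dots> = (LINT y|M. (u y)\<^sup>2) - 2 * a * a + a\<^sup>2 * measure M (space M)"
    using u True by (simp add: a_def)
  also have "\<dots> \<le> (LINT y|M. (u y)\<^sup>2) - 2 * a * a + a\<^sup>2 * 1"
    by (intro add_left_mono mult_left_mono subprob_measure_le_1) auto
  finally have "a\<^sup>2 \<le> (LINT y|M. (u y)\<^sup>2)" by (simp add: power2_eq_square)
  then show ?thesis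
    using nn_integral_eq_integral[OF True] by (simp add: a_def ennreal_leI)
next
  case False
  then have "(\<integral>\<^sup>+y. ennreal ((u y)\<^sup>2) \<partial>M) = \<infinity>"
    by (simp add: integrable_iff_bounded less_top[symmetric])
  then show ?thesis by simp
qed

lemma bounded_borelI: "f \<in> borel_measurable borel \<Longrightarrow> (\<And>x. \<bar>f x\<bar> \<le> C) \<Longrightarrow> f \<in> bounded_borel"
  by (auto simp: bounded_borel_def bounded_iff)

lemma bounded_borelE:
  assumes "f \<in> bounded_borel"
  obtains C where "0 \<le> C" "\<And>x. \<bar>f x\<bar> \<le> C" "f \<in> borel_measurable borel"
proof -
  obtain C where C: "\<And>x. \<bar>f x\<bar> \<le> C" using assms by (auto simp: bounded_borel_def bounded_iff)
  have "0 \<le> C" using C[of undefined] by linarith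
  with C assms that show ?thesis by (auto simp: bounded_borel_def)
qed

text \<open>The analytic content of the process: a symmetric strong Feller semigroup of sub-Markov kernels.
  Everything about ground states and quasi-stationarity happens at this level.\<close>

locale symmetric_semigroup =
  fixes m :: "'a::{metric_space, second_countable_topology} measure"
    and Q :: "real \<Rightarrow> 'a \<Rightarrow> 'a measure"
  assumes sets_m [measurable_cong, simp]: "sets m = sets borel"
    and sigma_finite_m: "sigma_finite_measure m"
    and full_support: "full_topological_support m"
    and kernel: "0 \<le> t \<Longrightarrow> Q t \<in> borel \<rightarrow>\<^sub>M subprob_algebra borel"
    and Q_0: "Q 0 x = return borel x"
    and emeasure_Q_add: "0 \<le> s \<Longrightarrow> 0 \<le> t \<Longrightarrow> B \<in> sets borel \<Longrightarrow>
        emeasure (Q (s + t) x) B = (\<integral>\<^sup>+y. emeasure (Q t y) B \<partial>Q s x)"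
    and symmetric: "0 < t \<Longrightarrow> f \<in> L2 m \<inter> bounded_borel \<Longrightarrow> g \<in> L2 m \<inter> bounded_borel \<Longrightarrow>
        (LINT x|m. (LINT y|Q t x. f y) * g x) = (LINT x|m. f x * (LINT y|Q t x. g y))"
    and feller: "0 < t \<Longrightarrow> f \<in> bounded_borel \<Longrightarrow> continuous_on UNIV (\<lambda>x. LINT y|Q t x. f y)"
    and measurable_Q_time:
      "B \<in> sets borel \<Longrightarrow> (\<lambda>t. emeasure (Q t x) B) \<in> borel_measurable (restrict_space borel {0..})"
begin

lemma space_m [simp]: "space m = UNIV"
  using sets_eq_imp_space_eq[OF sets_m] by simp

lemma
  assumes "0 \<le> t"
  shows subprob_Q: "subprob_space (Q t x)"
    and sets_Q [simp]: "sets (Q t x) = sets borel"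
    and space_Q [simp]: "space (Q t x) = UNIV"
  using subprob_measurableD[OF kernel[OF assms], of x] subprob_space_kernel[OF kernel[OF assms], of x] by auto

lemma borel_measurable_Q: "0 \<le> t \<Longrightarrow> f \<in> borel \<rightarrow>\<^sub>M N \<Longrightarrow> f \<in> Q t x \<rightarrow>\<^sub>M N"
  using measurable_cong_sets[OF sets_Q refl] by blast

lemma nn_integral_Q_measurable:
  "0 \<le> t \<Longrightarrow> f \<in> borel_measurable borel \<Longrightarrow> (\<lambda>x. \<integral>\<^sup>+y. f y \<partial>Q t x) \<in> borel_measurable borel"
  using measurable_compose[OF kernel nn_integral_measurable_subprob_algebra] by blast

lemma integral_Q_measurable:
  "0 \<le> t \<Longrightarrow> f \<in> borel_measurable borel \<Longrightarrow> (\<lambda>x. LINT y|Q t x. f y :: real) \<in> borel_measurable borel"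
  using measurable_compose[OF kernel integral_measurable_subprob_algebra] by blast

lemma Q_add: "0 \<le> s \<Longrightarrow> 0 \<le> t \<Longrightarrow> Q (s + t) x = Q s x \<bind> Q t"
proof (rule measure_eqI)
  assume st: "0 \<le> s" "0 \<le> t"
  have ker: "Q t \<in> Q s x \<rightarrow>\<^sub>M subprob_algebra borel"
    using kernel borel_measurable_Q st by blast
  show eq: "sets (Q (s + t) x) = sets (Q s x \<bind> Q t)"
    using st by (subst sets_bind[OF sets_kernel[OF ker]]) auto
  fix B assume "B \<in> sets (Q (s + t) x)"
  then have B: "B \<in> sets borel" using st by simp
  show "emeasure (Q (s + t) x) B = emeasure (Q s x \<bind> Q t) B"
    using st by (simp add: emeasure_bind[OF _ ker B] emeasure_Q_add B)
qed

lemma integrable_Q: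
  assumes t: "0 \<le> t" and f: "f \<in> bounded_borel"
  shows "integrable (Q t x) f"
proof -
  interpret subprob_space "Q t x" by (rule subprob_Q[OF t])
  obtain C where "0 \<le> C" and C: "\<And>x. \<bar>f x\<bar> \<le> C" "f \<in> borel_measurable borel"
    using bounded_borelE[OF f] by blast
  show ?thesis
    by (rule integrable_const_bound[of _ C]) (use C borel_measurable_Q[OF t] in auto)
qed

lemma integral_Q_bound:
  fixes f :: "'a \<Rightarrow> real"
  assumes t: "0 \<le> t" and "f \<in> borel_measurable borel" and C: "\<And>x. \<bar>f x\<bar> \<le> C"
  shows "\<bar>LINT y|Q t x. f y\<bar> \<le> C"
proof -
  interpret subprob_space "Q t x" by (rule subprob_Q[OF t])
  have f: "integrable (Q t x) f"
    by (rule integrable_Q[OF t bounded_borelI]) (rule assms)+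
  have "0 \<le> C" using C[of x] by linarith
  have "\<bar>LINT y|Q t x. f y\<bar> \<le> (LINT y|Q t x. \<bar>f y\<bar>)" by (rule integral_abs_bound)
  also have "\<dots> \<le> (LINT y|Q t x. C)" by (intro integral_mono) (use f C in auto)
  also have "\<dots> \<le> C" using \<open>0 \<le> C\<close> subprob_measure_le_1 mult_left_le[of "measure (Q t x) (space (Q t x))" C] by (simp add: mult.commute)
  finally show ?thesis .
qed

lemma integral_Q_bounded_borel: "0 \<le> t \<Longrightarrow> f \<in> bounded_borel \<Longrightarrow> (\<lambda>x. LINT y|Q t x. f y) \<in> bounded_borel"
  by (metis bounded_borelE bounded_borelI integral_Q_bound integral_Q_measurable)

lemma integral_Q_add:
  assumes st: "0 \<le> s" "0 \<le> t" and f: "f \<in> bounded_borel"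
  shows "(LINT z|Q (s + t) x. f z) = (LINT y|Q s x. LINT z|Q t y. f z)"
proof -
  have ker: "Q t \<in> Q s x \<rightarrow>\<^sub>M subprob_algebra borel"
    using kernel borel_measurable_Q st by blast
  obtain C where "0 \<le> C" and C: "\<And>x. \<bar>f x\<bar> \<le> C" "f \<in> borel_measurable borel"
    using bounded_borelE[OF f] by blast
  have "(LINT z|(Q s x \<bind> Q t). f z) = (LINT y|Q s x. LINT z|Q t y. f z)"
    using subprob_space.emeasure_space_le_1[OF subprob_Q] st C
    by (intro integral_bind[OF C(2) _ ker, of C 1]) (auto simp: C subprob_space.axioms(1)[OF subprob_Q])
  then show ?thesis by (simp add: Q_add st)
qed

lemma nn_symmetric_limit:
  assumes t: "0 \<le> t" and f: "f \<in> borel_measurable borel"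
    and g: "\<And>n::nat. g n \<in> borel_measurable borel" "incseq g"
    and eq: "\<And>n. (\<integral>\<^sup>+x. f x * (\<integral>\<^sup>+y. g n y \<partial>Q t x) \<partial>m) = (\<integral>\<^sup>+x. g n x * (\<integral>\<^sup>+y. f y \<partial>Q t x) \<partial>m)"
  shows "(\<integral>\<^sup>+x. f x * (\<integral>\<^sup>+y. (SUP n. g n y) \<partial>Q t x) \<partial>m) = (\<integral>\<^sup>+x. (SUP n. g n x) * (\<integral>\<^sup>+y. f y \<partial>Q t x) \<partial>m)"
proof -
  have mono: "g i x \<le> g j x" if "i \<le> j" for i j x using g(2) that by (auto simp: incseq_def le_fun_def)
  note [measurable] = f g(1) nn_integral_Q_measurable[OF t f] nn_integral_Q_measurable[OF t g(1)]
  have "(\<integral>\<^sup>+x. f x * (\<integral>\<^sup>+y. (SUP n. g n y) \<partial>Q t x) \<partial>m) = (\<integral>\<^sup>+x. (SUP n. f x * (\<integral>\<^sup>+y. g n y \<partial>Q t x)) \<partial>m)"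
    using nn_integral_monotone_convergence_SUP[OF g(2) borel_measurable_Q[OF t g(1)]]
    by (simp add: SUP_mult_left_ennreal)
  also have "\<dots> = (SUP n. \<integral>\<^sup>+x. f x * (\<integral>\<^sup>+y. g n y \<partial>Q t x) \<partial>m)"
    by (intro nn_integral_monotone_convergence_SUP)
       (auto simp: incseq_def le_fun_def intro!: mult_left_mono nn_integral_mono mono)
  also have "\<dots> = (SUP n. \<integral>\<^sup>+x. g n x * (\<integral>\<^sup>+y. f y \<partial>Q t x) \<partial>m)"
    by (simp add: eq)
  also have "\<dots> = (\<integral>\<^sup>+x. (SUP n. g n x * (\<integral>\<^sup>+y. f y \<partial>Q t x)) \<partial>m)"
    by (intro nn_integral_monotone_convergence_SUP[symmetric])
       (auto simp: incseq_def le_fun_def intro!: mult_right_mono mono)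
  also have "\<dots> = (\<integral>\<^sup>+x. (SUP n. g n x) * (\<integral>\<^sup>+y. f y \<partial>Q t x) \<partial>m)"
    by (simp add: SUP_mult_right_ennreal)
  finally show ?thesis .
qed

lemma nn_symmetric_bounded:
  fixes f g :: "'a \<Rightarrow> real"
  assumes t: "0 < t" and f: "f \<in> L2 m \<inter> bounded_borel" "integrable m f" "\<And>x. 0 \<le> f x"
    and g: "g \<in> L2 m \<inter> bounded_borel" "integrable m g" "\<And>x. 0 \<le> g x"
  shows "(\<integral>\<^sup>+x. f x * (\<integral>\<^sup>+y. g y \<partial>Q t x) \<partial>m) = (\<integral>\<^sup>+x. g x * (\<integral>\<^sup>+y. f y \<partial>Q t x) \<partial>m)"
proof -
  have *: "(\<integral>\<^sup>+x. f x * (\<integral>\<^sup>+y. g y \<partial>Q t x) \<partial>m) = ennreal (LINT x|m. f x * (LINT y|Q t x. g y))"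
    if f: "f \<in> L2 m \<inter> bounded_borel" "integrable m f" "\<And>x. 0 \<le> f x"
      and g: "g \<in> L2 m \<inter> bounded_borel" "integrable m g" "\<And>x. 0 \<le> g x" for f g :: "'a \<Rightarrow> real"
  proof -
    have bb: "(\<lambda>x. LINT y|Q t x. g y) \<in> bounded_borel" using t g by (intro integral_Q_bounded_borel) auto
    obtain C where C: "\<And>x. \<bar>LINT y|Q t x. g y\<bar> \<le> C" using bounded_borelE[OF bb] by blast
    have [measurable]: "(\<lambda>x. LINT y|Q t x. g y) \<in> borel_measurable borel" "f \<in> borel_measurable borel"
      using bb f by (auto simp: bounded_borel_def)
    have int: "integrable m (\<lambda>x. f x * (LINT y|Q t x. g y))"
    proof (rule Bochner_Integration.integrable_bound)
      show "integrable m (\<lambda>x. C * f x)" using f by simp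
      show "AE x in m. norm (f x * (LINT y|Q t x. g y)) \<le> norm (C * f x)"
        using C f(3) order_trans[OF C abs_ge_self]
        by (auto simp: abs_mult mult.commute[of C] intro!: AE_I2 mult_left_mono)
    qed simp
    have "(\<integral>\<^sup>+y. g y \<partial>Q t x) = ennreal (LINT y|Q t x. g y)" for x
      using t g by (intro nn_integral_eq_integral integrable_Q) auto
    then have "(\<integral>\<^sup>+x. f x * (\<integral>\<^sup>+y. g y \<partial>Q t x) \<partial>m) = (\<integral>\<^sup>+x. ennreal (f x * (LINT y|Q t x. g y)) \<partial>m)"
      using f(3) g(3) by (simp add: ennreal_mult)
    also have "\<dots> = ennreal (LINT x|m. f x * (LINT y|Q t x. g y))"
      using int f(3) g(3) by (intro nn_integral_eq_integral) auto
    finally show ?thesis .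
  qed
  show ?thesis
    unfolding *[OF f g] *[OF g f] using symmetric[OF t f(1) g(1)] by (simp add: mult.commute)
qed

text \<open>Symmetry for all nonnegative measurable functions, infinite values included: cut both functions off
  in height and to sets of finite measure, and pass to the limit one argument at a time.\<close>

lemma nn_symmetric:
  assumes t: "0 \<le> t" and f: "f \<in> borel_measurable borel" and g: "g \<in> borel_measurable borel"
  shows "(\<integral>\<^sup>+x. f x * (\<integral>\<^sup>+y. g y \<partial>Q t x) \<partial>m) = (\<integral>\<^sup>+x. g x * (\<integral>\<^sup>+y. f y \<partial>Q t x) \<partial>m)"
proof (cases "t = 0")
  case True
  then show ?thesis using f g by (simp add: Q_0 nn_integral_return mult.commute)
next
  case False
  with t have t: "0 < t" by simp
  obtain A :: "nat \<Rightarrow> 'a set" where A: "range A \<subseteq> sets m" "(\<Union>i. A i) = space m"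
      "\<And>i. emeasure m (A i) \<noteq> \<infinity>" "incseq A"
    using sigma_finite_measure.sigma_finite_incseq[OF sigma_finite_m] by blast
  have [measurable]: "A i \<in> sets borel" for i using A(1) by auto
  define cut :: "('a \<Rightarrow> ennreal) \<Rightarrow> nat \<Rightarrow> 'a \<Rightarrow> real" where
    "cut h n x = enn2real (min (h x) (of_nat n)) * indicator (A n) x" for h n x
  have cut_eq: "ennreal (cut h n x) = min (h x) (of_nat n) * indicator (A n) x" for h n x
  proof -
    have "min (h x) (of_nat n) < \<top>" by (simp add: min_less_iff_disj of_nat_less_top)
    then show ?thesis by (auto simp: cut_def indicator_def)
  qed
  have cut_meas [measurable]: "cut h n \<in> borel_measurable borel" if [measurable]: "h \<in> borel_measurable borel" for h n
    unfolding cut_def by measurable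
  have cut_le: "0 \<le> cut h n x" "cut h n x \<le> real n * indicator (A n) x" for h n x
    using enn2real_mono[of "min (h x) (of_nat n)" "of_nat n"]
    by (auto simp: cut_def indicator_def of_nat_less_top)
  have cut_bb: "cut h n \<in> bounded_borel" if "h \<in> borel_measurable borel" for h n
  proof (rule bounded_borelI[of _ "real n"])
    show "\<bar>cut h n x\<bar> \<le> real n" for x
      using cut_le[of h n x] by (cases "x \<in> A n") auto
  qed (use that in simp)
  have int_A: "integrable m (\<lambda>x. c * indicator (A n) x)" for n and c :: real
    using A(3)[of n] by (intro integrable_mult_right integrable_real_indicator) (auto simp: less_top)
  have cut_int: "integrable m (cut h n)" if "h \<in> borel_measurable borel" for h n
    by (rule Bochner_Integration.integrable_bound[OF int_A[of "real n" n]]) (use cut_le[of h n] that in auto)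
  have cut_L2: "cut h n \<in> L2 m" if [measurable]: "h \<in> borel_measurable borel" for h n
  proof -
    have "integrable m (\<lambda>x. (cut h n x)\<^sup>2)"
    proof (rule Bochner_Integration.integrable_bound[OF int_A[of "(real n)\<^sup>2" n]])
      show "AE x in m. norm ((cut h n x)\<^sup>2) \<le> norm ((real n)\<^sup>2 * indicator (A n) x)"
      proof (rule AE_I2)
        fix x show "norm ((cut h n x)\<^sup>2) \<le> norm ((real n)\<^sup>2 * indicator (A n) x)"
          using cut_le[of h n x] by (cases "x \<in> A n") (auto intro: power_mono)
      qed
    qed simp
    then show ?thesis by (auto simp: L2_def)
  qed
  have SUP_cut: "(SUP n. ennreal (cut h n x)) = h x" for h x
  proof (rule antisym)
    show "(SUP n. ennreal (cut h n x)) \<le> h x"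
      by (rule SUP_least) (auto simp: cut_eq indicator_def)
    obtain k where k: "x \<in> A k" using A(2) by auto
    have "h x = (SUP n. min (h x) (of_nat n))"
      by (simp add: inf_min[symmetric] inf_SUP[symmetric] ennreal_SUP_of_nat_eq_top)
    also have "\<dots> \<le> (SUP n. ennreal (cut h n x))"
    proof (rule SUP_mono)
      fix n
      have "x \<in> A (max n k)" using k A(4) by (meson incseqD max.cobounded2 subsetD)
      then have "min (h x) (of_nat n) \<le> ennreal (cut h (max n k) x)"
        by (auto simp: cut_eq min.coboundedI2 intro: min.mono)
      then show "\<exists>j\<in>UNIV. min (h x) (of_nat n) \<le> ennreal (cut h j x)" by blast
    qed
    finally show "h x \<le> (SUP n. ennreal (cut h n x))" .
  qed
  have inc_cut: "incseq (\<lambda>n x. ennreal (cut h n x))" for h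
    unfolding incseq_def le_fun_def cut_eq
  proof (intro allI impI mult_mono min.mono)
    show "indicator (A i) x \<le> (indicator (A j) x :: ennreal)" if "i \<le> j" for i j x
      using incseqD[OF A(4) that] by (auto simp: indicator_def)
  qed simp_all
  have 1: "(\<integral>\<^sup>+x. cut f n x * (\<integral>\<^sup>+y. cut g k y \<partial>Q t x) \<partial>m) = (\<integral>\<^sup>+x. cut g k x * (\<integral>\<^sup>+y. cut f n y \<partial>Q t x) \<partial>m)" for n k
    using f g by (intro nn_symmetric_bounded t) (auto simp: cut_bb cut_L2 cut_int cut_le)
  have 2: "(\<integral>\<^sup>+x. cut f n x * (\<integral>\<^sup>+y. g y \<partial>Q t x) \<partial>m) = (\<integral>\<^sup>+x. g x * (\<integral>\<^sup>+y. cut f n y \<partial>Q t x) \<partial>m)" for n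
    using nn_symmetric_limit[of t "\<lambda>x. ennreal (cut f n x)" "\<lambda>k x. ennreal (cut g k x)"] t f g inc_cut[of g] 1
    by (simp add: SUP_cut)
  show ?thesis
    using nn_symmetric_limit[of t g "\<lambda>k x. ennreal (cut f k x)"] t f g inc_cut[of f] 2
    by (simp add: SUP_cut)
qed

lemma nn_integral_Q_le:
  assumes t: "0 \<le> t" and f: "f \<in> borel_measurable borel"
  shows "(\<integral>\<^sup>+x. (\<integral>\<^sup>+y. f y \<partial>Q t x) \<partial>m) \<le> (\<integral>\<^sup>+x. f x \<partial>m)"
proof -
  have "(\<integral>\<^sup>+x. (\<integral>\<^sup>+y. f y \<partial>Q t x) \<partial>m) = (\<integral>\<^sup>+x. f x * emeasure (Q t x) (space (Q t x)) \<partial>m)"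
    using nn_symmetric[OF t, of "\<lambda>_. 1" f] f by simp
  also have "\<dots> \<le> (\<integral>\<^sup>+x. f x * 1 \<partial>m)"
    by (intro nn_integral_mono mult_left_mono subprob_space.emeasure_space_le_1 subprob_Q t) simp
  finally show ?thesis by simp
qed

text \<open>The kernels contract \<open>L\<^sup>2\<close>, because \<open>(p\<^sub>t u)\<^sup>2 \<le> p\<^sub>t (u\<^sup>2)\<close> and \<open>p\<^sub>t\<close> does not increase the
  \<open>m\<close>-integral. The function \<open>u\<close> may be unbounded; this is what bounds the Dirichlet form below on
  its whole domain.\<close>

lemma
  assumes t: "0 \<le> t" and u: "u \<in> L2 m"
  shows integral_Q_L2: "(\<lambda>x. LINT y|Q t x. u y) \<in> L2 m"
    and L2_contraction: "(LINT x|m. (LINT y|Q t x. u y)\<^sup>2) \<le> (LINT x|m. (u x)\<^sup>2)"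
proof -
  have [measurable]: "u \<in> borel_measurable borel" using u by (auto simp: L2_def)
  have [measurable]: "(\<lambda>x. LINT y|Q t x. u y) \<in> borel_measurable borel" by (rule integral_Q_measurable[OF t]) simp
  have u2: "integrable m (\<lambda>x. (u x)\<^sup>2)" using u by (auto simp: L2_def)
  have "(\<integral>\<^sup>+x. ennreal ((LINT y|Q t x. u y)\<^sup>2) \<partial>m) \<le> (\<integral>\<^sup>+x. (\<integral>\<^sup>+y. ennreal ((u y)\<^sup>2) \<partial>Q t x) \<partial>m)"
    by (intro nn_integral_mono subprob_space.square_integral_le subprob_Q t borel_measurable_Q) simp
  also have "\<dots> \<le> (\<integral>\<^sup>+x. ennreal ((u x)\<^sup>2) \<partial>m)"
    by (rule nn_integral_Q_le[OF t]) simp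
  also have "\<dots> = ennreal (LINT x|m. (u x)\<^sup>2)"
    by (rule nn_integral_eq_integral[OF u2]) simp
  finally have le: "(\<integral>\<^sup>+x. ennreal ((LINT y|Q t x. u y)\<^sup>2) \<partial>m) \<le> ennreal (LINT x|m. (u x)\<^sup>2)" .
  then have "integrable m (\<lambda>x. (LINT y|Q t x. u y)\<^sup>2)"
    by (auto simp: integrable_iff_bounded intro: le_less_trans)
  then show "(\<lambda>x. LINT y|Q t x. u y) \<in> L2 m" by (auto simp: L2_def)
  show "(LINT x|m. (LINT y|Q t x. u y)\<^sup>2) \<le> (LINT x|m. (u x)\<^sup>2)"
    using le by (subst integral_eq_nn_integral) (auto intro!: enn2real_leI)
qed

end

section \<open>Minimizers of the form are eigenfunctions\<close>

lemma L2_integral_square_diff: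
  assumes u: "u \<in> L2 m" and v: "v \<in> L2 m"
  shows "integrable m (\<lambda>x. (u x - a * v x)\<^sup>2)"
    and "(LINT x|m. (u x - a * v x)\<^sup>2)
      = (LINT x|m. u x * u x) - 2 * a * (LINT x|m. u x * v x) + a\<^sup>2 * (LINT x|m. v x * v x)"
proof -
  have eq: "(\<lambda>x. (u x - a * v x)\<^sup>2) = (\<lambda>x. u x * u x - 2 * a * (u x * v x) + a\<^sup>2 * (v x * v x))"
    by (auto simp: power2_eq_square algebra_simps)
  note int = L2_integrable_mult[OF u u] L2_integrable_mult[OF u v] L2_integrable_mult[OF v v]
  show "integrable m (\<lambda>x. (u x - a * v x)\<^sup>2)"
    unfolding eq using int by (intro Bochner_Integration.integrable_add Bochner_Integration.integrable_diff integrable_mult_right)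
  show "(LINT x|m. (u x - a * v x)\<^sup>2)
      = (LINT x|m. u x * u x) - 2 * a * (LINT x|m. u x * v x) + a\<^sup>2 * (LINT x|m. v x * v x)"
    unfolding eq using int by simp
qed

context symmetric_semigroup
begin

abbreviation act :: "real \<Rightarrow> ('a \<Rightarrow> real) \<Rightarrow> 'a \<Rightarrow> real" where
  "act t f \<equiv> (\<lambda>x. LINT y|Q t x. f y)"

lemma act_0: "f \<in> borel_measurable borel \<Longrightarrow> act 0 f x = f x"
  by (simp add: Q_0 integral_return)

lemma symmetric_act:
  assumes t: "0 \<le> t" and f: "f \<in> L2 m \<inter> bounded_borel" and g: "g \<in> L2 m \<inter> bounded_borel"
  shows "(LINT x|m. act t f x * g x) = (LINT x|m. f x * act t g x)"
proof (cases "t = 0")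
  case True
  with f g show ?thesis by (auto simp: act_0 bounded_borel_def)
next
  case False
  with t symmetric[OF _ f g] show ?thesis by simp
qed

lemma act_in: "0 \<le> t \<Longrightarrow> f \<in> L2 m \<inter> bounded_borel \<Longrightarrow> act t f \<in> L2 m \<inter> bounded_borel"
  using integral_Q_L2 integral_Q_bounded_borel by blast

lemma inner_act_act:
  assumes st: "0 \<le> s" "0 \<le> t" and f: "f \<in> L2 m \<inter> bounded_borel"
  shows "(LINT x|m. act s f x * act t f x) = (LINT x|m. f x * act (s + t) f x)"
  using symmetric_act[OF st(1) f act_in[OF st(2) f]] integral_Q_add[OF st, of f] f by simp

lemma approx_form_nonneg:
  assumes t: "0 \<le> t" and u: "u \<in> L2 m"
  shows "0 \<le> (LINT x|m. (u x - act t u x) * u x)"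
proof -
  note v = integral_Q_L2[OF t u]
  have "0 \<le> (LINT x|m. (act t u x - 1 * u x)\<^sup>2)" by simp
  also have "\<dots> = (LINT x|m. act t u x * act t u x) - 2 * (LINT x|m. act t u x * u x) + (LINT x|m. u x * u x)"
    using L2_integral_square_diff(2)[OF v u, of 1] by simp
  also have "\<dots> \<le> 2 * (LINT x|m. u x * u x) - 2 * (LINT x|m. act t u x * u x)"
    using L2_contraction[OF t u] by (simp add: power2_eq_square)
  also have "\<dots> = 2 * (LINT x|m. (u x - act t u x) * u x)"
    using L2_integrable_mult[OF u u] L2_integrable_mult[OF v u] by (simp add: left_diff_distrib)
  finally show ?thesis by simp
qed

text \<open>The correlation \<open>F s = (\<phi>, p\<^sub>s \<phi>)\<close> is nonincreasing, midpoint convex and satisfies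
  \<open>(F s)\<^sup>2 \<le> F (2 s)\<close>, all because \<open>F (r + s) = (p\<^sub>r \<phi>, p\<^sub>s \<phi>)\<close>. The form at
  \<open>p\<^sub>s\<^sub>/\<^sub>2 \<phi>\<close> is the downward slope of \<open>F\<close> at \<open>s\<close>, so minimality bounds that slope below and forces
  \<open>F s = exp (- c s)\<close>. Equality in Cauchy--Schwarz, in the form
  \<open>\<parallel>p\<^sub>t \<phi> - exp (- c t) \<phi>\<parallel>\<^sup>2 = 0\<close>, gives the claim.\<close>

theorem minimizer_is_eigenfunction:
  assumes phi: "\<phi> \<in> L2 m \<inter> bounded_borel" and norm: "(LINT x|m. \<phi> x * \<phi> x) = 1"
    and init: "((\<lambda>t. 1 / t * (LINT x|m. (\<phi> x - act t \<phi> x) * \<phi> x)) \<longlongrightarrow> c) (at_right 0)"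
    and minimal: "\<And>w l. w \<in> L2 m \<Longrightarrow> (LINT x|m. w x * w x) = 1 \<Longrightarrow>
      ((\<lambda>t. 1 / t * (LINT x|m. (w x - act t w x) * w x)) \<longlongrightarrow> l) (at_right 0) \<Longrightarrow> c \<le> l"
    and t: "0 \<le> t"
  shows "0 \<le> c" and "AE x in m. act t \<phi> x = exp (- c * t) * \<phi> x"
proof -
  define F where "F s = (LINT x|m. \<phi> x * act s \<phi> x)" for s
  have phi_L2: "\<phi> \<in> L2 m" and phi_bb: "\<phi> \<in> bounded_borel" and phi_meas: "\<phi> \<in> borel_measurable borel"
    using phi by (auto simp: bounded_borel_def)
  have L2: "act s \<phi> \<in> L2 m" if "0 \<le> s" for s using act_in[OF that phi] by simp
  have ip: "(LINT x|m. act r \<phi> x * act s \<phi> x) = F (r + s)" if "0 \<le> r" "0 \<le> s" for r s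
    using inner_act_act[OF that phi] by (simp add: F_def)
  have ip0: "(LINT x|m. act s \<phi> x * \<phi> x) = F s" for s
    by (simp add: F_def mult.commute)
  have F0: "F 0 = 1" using norm by (simp add: F_def act_0[OF phi_meas])
  have nonneg: "0 \<le> F s" if "0 \<le> s" for s
  proof -
    have "0 \<le> (LINT x|m. act (s/2) \<phi> x * act (s/2) \<phi> x)"
      by (intro integral_nonneg_AE) simp
    then show ?thesis using ip[of "s/2" "s/2"] that by simp
  qed
  have mid: "2 * F ((r + s) / 2) \<le> F r + F s" if "0 \<le> r" "0 \<le> s" for r s
  proof -
    have "0 \<le> (LINT x|m. (act (r/2) \<phi> x - 1 * act (s/2) \<phi> x)\<^sup>2)" by simp
    also have "\<dots> = F (r/2 + r/2) - 2 * F (r/2 + s/2) + F (s/2 + s/2)"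
      using that by (subst L2_integral_square_diff(2)) (auto simp: L2 ip simp del: field_sum_of_halves)
    finally show ?thesis by (simp add: add_divide_distrib)
  qed
  have anti: "F s \<le> F r" if "0 \<le> r" "r \<le> s" for r s
  proof -
    have eq: "act (s/2) \<phi> x = act ((s - r)/2) (act (r/2) \<phi>) x" for x
      using integral_Q_add[of "(s - r)/2" "r/2" \<phi> x] that phi_bb by (simp add: diff_divide_distrib)
    have "(LINT x|m. (act (s/2) \<phi> x)\<^sup>2) \<le> (LINT x|m. (act (r/2) \<phi> x)\<^sup>2)"
      unfolding eq using that by (intro L2_contraction L2) auto
    then show ?thesis using ip[of "s/2" "s/2"] ip[of "r/2" "r/2"] that by (simp add: power2_eq_square)
  qed
  have square: "(F s)\<^sup>2 \<le> F (2 * s)" if "0 \<le> s" for s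
  proof -
    have "0 \<le> (LINT x|m. (act s \<phi> x - F s * \<phi> x)\<^sup>2)" by simp
    also have "\<dots> = F (s + s) - 2 * F s * F s + (F s)\<^sup>2 * 1"
      unfolding L2_integral_square_diff(2)[OF L2[OF that] phi_L2] ip[OF that that] ip0 norm by (rule refl)
    finally show ?thesis by (simp add: power2_eq_square)
  qed
  have init': "((\<lambda>t. (1 - F t) / t) \<longlongrightarrow> c) (at_right 0)"
  proof (rule Lim_transform_eventually[OF init])
    show "\<forall>\<^sub>F t in at_right 0. 1 / t * (LINT x|m. (\<phi> x - act t \<phi> x) * \<phi> x) = (1 - F t) / t"
      using eventually_at_right_less[of 0]
    proof eventually_elim
      case (elim t)
      then show ?case
        using L2_integrable_mult[OF phi_L2 phi_L2] L2_integrable_mult[OF L2 phi_L2, of t] norm ip0[of t]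
        by (simp add: left_diff_distrib)
    qed
  qed
  have slope: "c * F s \<le> l"
    if s: "0 \<le> s" and l: "((\<lambda>t. (F s - F (s + t)) / t) \<longlongrightarrow> l) (at_right 0)" for s l
  proof (cases "F s = 0")
    case True
    have "0 \<le> l"
      using eventually_at_right_less[of "0::real"]
      by (intro tendsto_lowerbound[OF l]) (auto elim!: eventually_mono intro!: divide_nonneg_pos anti s)
    with True show ?thesis by simp
  next
    case False
    with nonneg[OF s] have pos: "0 < F s" by simp
    \<comment> \<open>\<open>w\<close> is \<open>p\<^sub>s\<^sub>/\<^sub>2 \<phi>\<close> normalized in \<open>L\<^sup>2\<close>, since \<open>F s\<close> is the square of its norm.\<close>
    define k where "k = 1 / sqrt (F s)"
    have kk: "k * k = 1 / F s" using pos by (simp add: k_def)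
    define w where "w x = k * act (s/2) \<phi> x" for x
    have w_L2: "w \<in> L2 m" unfolding w_def using L2[of "s/2"] s by (intro L2_cmult) auto
    have w_eq: "(LINT x|m. (w x - act t w x) * w x) = (F s - F (s + t)) / F s" if t: "0 \<le> t" for t
    proof -
      have act_w: "act t w x = k * act (t + s/2) \<phi> x" for x
        unfolding w_def using t s phi_bb by (simp add: integral_Q_add)
      have "(\<lambda>x. (w x - act t w x) * w x)
          = (\<lambda>x. (k * k) * (act (s/2) \<phi> x * act (s/2) \<phi> x - act (t + s/2) \<phi> x * act (s/2) \<phi> x))"
        unfolding act_w unfolding w_def by (simp add: algebra_simps)
      moreover have "(LINT x|m. act (s/2) \<phi> x * act (s/2) \<phi> x - act (t + s/2) \<phi> x * act (s/2) \<phi> x) = F s - F (s + t)"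
        using t s ip[of "s/2" "s/2"] ip[of "t + s/2" "s/2"] by (simp add: L2_integrable_mult L2 add.commute)
      ultimately show ?thesis by (simp add: kk)
    qed
    have w_norm: "(LINT x|m. w x * w x) = 1"
    proof -
      have "(\<lambda>x. w x * w x) = (\<lambda>x. (k * k) * (act (s/2) \<phi> x * act (s/2) \<phi> x))"
        by (simp add: w_def fun_eq_iff)
      then show ?thesis using kk ip[of "s/2" "s/2"] s pos by simp
    qed
    have "((\<lambda>t. 1 / t * (LINT x|m. (w x - act t w x) * w x)) \<longlongrightarrow> l / F s) (at_right 0)"
    proof (rule Lim_transform_eventually[OF tendsto_divide[OF l tendsto_const[of "F s"]]])
      show "\<forall>\<^sub>F t in at_right 0. (F s - F (s + t)) / t / F s = 1 / t * (LINT x|m. (w x - act t w x) * w x)"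
        using eventually_at_right_less[of 0] by eventually_elim (simp add: w_eq)
    qed (use pos in simp)
    from minimal[OF w_L2 w_norm this] show ?thesis using pos by (simp add: field_simps)
  qed
  note exponential = exponential_from_minimal_initial_slope[of F, OF mid anti nonneg square init' F0 slope]
  show "0 \<le> c" by (rule exponential(1)[OF _ _ _ _ _ _ _ _ t])
  have F_exp: "F s = exp (- c * s)" if "0 \<le> s" for s by (rule exponential(2)[OF _ _ _ _ _ _ _ _ that])
  let ?e = "exp (- c * t)"
  have "(LINT x|m. (act t \<phi> x - ?e * \<phi> x)\<^sup>2) = F (t + t) - 2 * ?e * F t + ?e\<^sup>2 * 1"
    unfolding L2_integral_square_diff(2)[OF L2[OF t] phi_L2] ip[OF t t] ip0 norm by (rule refl)
  also have "\<dots> = 0"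
    using t by (simp add: F_exp power2_eq_square exp_add[symmetric] algebra_simps)
  finally have "AE x in m. (act t \<phi> x - ?e * \<phi> x)\<^sup>2 = 0"
    using integral_nonneg_eq_0_iff_AE[OF L2_integral_square_diff(1)[OF L2[OF t] phi_L2]] by simp
  then show "AE x in m. act t \<phi> x = ?e * \<phi> x" by eventually_elim simp
qed

text \<open>The set where two continuous functions differ is open, so it cannot be a nonempty null set of a
  measure with full support. With the strong Feller property this turns statements that hold almost
  everywhere into statements at every point.\<close>

lemma continuous_AE_eqI:
  fixes f g :: "'a \<Rightarrow> 'b::t2_space"
  assumes f: "continuous_on UNIV f" and g: "continuous_on UNIV g" and ae: "AE x in m. f x = g x"
  shows "f x = g x"
proof -
  have op: "open {x. f x \<noteq> g x}" by (rule open_Collect_neq[OF f g])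
  then have "{x. f x \<noteq> g x} \<in> sets m" by simp
  then have "emeasure m {x. f x \<noteq> g x} = 0"
    using ae AE_iff_measurable[of "{x. f x \<noteq> g x}" m "\<lambda>x. f x = g x"] by simp
  then have "{x. f x \<noteq> g x} = {}"
    using full_support op by (auto simp: full_topological_support_def)
  then show ?thesis by auto
qed

end

section \<open>Integrability of eigenfunctions under tightness\<close>

text \<open>Functions measurable in one argument and continuous in the other are jointly measurable
  (Caratheodory): replace the second argument by the first point of a countable dense sequence within
  distance \<open>1 / (n + 1)\<close>, and let \<open>n\<close> grow.\<close>

lemma measurable_continuous_in_second_argument:
  fixes f :: "'t \<Rightarrow> 'a::{metric_space, second_countable_topology} \<Rightarrow> 'b::metric_space"
  assumes meas: "\<And>x. (\<lambda>t. f t x) \<in> borel_measurable N"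
    and cont: "\<And>t. t \<in> space N \<Longrightarrow> continuous_on UNIV (f t)"
  shows "(\<lambda>(t, x). f t x) \<in> borel_measurable (N \<Otimes>\<^sub>M borel)"
proof -
  obtain D :: "'a set" where D: "countable D" "\<And>U. open U \<Longrightarrow> U \<noteq> {} \<Longrightarrow> \<exists>d\<in>D. d \<in> U"
    using countable_dense_exists by blast
  define d where "d = from_nat_into D"
  have dense: "\<exists>k. dist (d k) x < r" if "0 < r" for x r
  proof -
    have "ball x r \<noteq> {}" using that by simp
    then obtain y where "y \<in> D" "y \<in> ball x r" using D(2)[OF open_ball] by blast
    then show ?thesis
      using from_nat_into_to_nat_on[OF D(1)] by (metis d_def mem_ball dist_commute)
  qed
  define k where "k n x = (LEAST k. dist (d k) x < 1 / Suc n)" for n x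
  have k: "dist (d (k n x)) x < 1 / Suc n" for n x
    unfolding k_def by (rule LeastI_ex) (rule dense, simp)
  have [measurable]: "k n \<in> borel \<rightarrow>\<^sub>M count_space UNIV" for n
    unfolding k_def by measurable
  show ?thesis
  proof (rule borel_measurable_LIMSEQ_metric)
    fix n
    have "(\<lambda>p. f (fst p) (d j)) \<in> borel_measurable (N \<Otimes>\<^sub>M (borel :: 'a measure))" for j
      using measurable_compose[OF measurable_fst meas] by blast
    then show "(\<lambda>p. f (fst p) (d (k n (snd p)))) \<in> borel_measurable (N \<Otimes>\<^sub>M borel)"
      by (rule measurable_compose_countable) measurable
  next
    fix p :: "'t \<times> 'a" assume "p \<in> space (N \<Otimes>\<^sub>M borel)"
    then have "fst p \<in> space N" by (auto simp: space_pair_measure)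
    have "(\<lambda>n. d (k n (snd p))) \<longlonglongrightarrow> snd p"
    proof (rule metric_LIMSEQ_I)
      fix r :: real assume "0 < r"
      then obtain m where m: "1 / Suc m < r" using nat_approx_posE by metis
      have "dist (d (k n (snd p))) (snd p) < r" if "m \<le> n" for n
      proof -
        have "1 / real (Suc n) \<le> 1 / real (Suc m)" using that by (simp add: frac_le)
        with k[of n "snd p"] m show ?thesis by linarith
      qed
      then show "\<exists>m. \<forall>n\<ge>m. dist (d (k n (snd p))) (snd p) < r" by blast
    qed
    then have "(\<lambda>n. f (fst p) (d (k n (snd p)))) \<longlonglongrightarrow> f (fst p) (snd p)"
      using continuous_on_tendsto_compose[OF cont[OF \<open>fst p \<in> space N\<close>]] by fastforce
    then show "(\<lambda>n. f (fst p) (d (k n (snd p)))) \<longlonglongrightarrow> (case p of (t, x) \<Rightarrow> f t x)"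
      by (simp add: case_prod_beta)
  qed
qed

lemma nn_integral_halfline_closed_eq_open:
  "(\<integral>\<^sup>+t. f t \<partial>restrict_space lborel {0::real..}) = (\<integral>\<^sup>+t. f t \<partial>restrict_space lborel {0<..})"
proof -
  have "(\<integral>\<^sup>+t. f t \<partial>restrict_space lborel {0..}) = (\<integral>\<^sup>+t. f t * indicator {0..} t \<partial>lborel)"
    by (rule nn_integral_restrict_space) simp
  also have "\<dots> = (\<integral>\<^sup>+t. f t * indicator {0<..} t \<partial>lborel)"
    by (rule nn_integral_cong_AE) (use AE_lborel_singleton[of 0] in eventually_elim, auto simp: indicator_def)
  also have "\<dots> = (\<integral>\<^sup>+t. f t \<partial>restrict_space lborel {0<..})"
    by (rule nn_integral_restrict_space[symmetric]) simp
  finally show ?thesis .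
qed

lemma nn_integral_exp_halfline:
  assumes a: "0 < a"
  shows "(\<integral>\<^sup>+t. ennreal (exp (- a * t)) \<partial>restrict_space lborel {0<..}) = ennreal (1 / a)"
proof -
  have "(\<integral>\<^sup>+t. ennreal (exp (- a * t)) \<partial>restrict_space lborel {0<..})
      = (\<integral>\<^sup>+t. ennreal (exp (- a * t)) * indicator {0..} t \<partial>lborel)"
    unfolding nn_integral_halfline_closed_eq_open[symmetric] by (rule nn_integral_restrict_space) simp
  also have "\<dots> = ennreal (0 - (- exp (- a * 0) / a))"
  proof (rule nn_integral_FTC_atLeast)
    show "((\<lambda>t. - exp (- a * t) / a) \<longlongrightarrow> 0) at_top" using a by real_asymp
    show "((\<lambda>t. - exp (- a * t) / a) has_real_derivative exp (- a * t)) (at t)" for t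
      using a by (auto intro!: derivative_eq_intros)
  qed auto
  finally show ?thesis by simp
qed

context symmetric_semigroup
begin

text \<open>The resolvent of order one. Time 0 is left out because the kernels are continuous in the starting
  point only for positive times.\<close>

definition resolvent :: "('a \<Rightarrow> ennreal) \<Rightarrow> 'a \<Rightarrow> ennreal" where
  "resolvent f x = (\<integral>\<^sup>+t. ennreal (exp (- t)) * (\<integral>\<^sup>+y. f y \<partial>Q t x) \<partial>restrict_space lborel {0<..})"

lemma measurable_Q_joint:
  "(\<lambda>(t, x). Q t x) \<in> restrict_space lborel {0<..} \<Otimes>\<^sub>M borel \<rightarrow>\<^sub>M subprob_algebra borel"
proof (rule measurable_subprob_algebra)
  fix p assume "p \<in> space (restrict_space lborel {0::real<..} \<Otimes>\<^sub>M (borel :: 'a measure))"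
  then have "0 \<le> fst p" by (auto simp: space_pair_measure space_restrict_space)
  then show "subprob_space (case p of (t, x) \<Rightarrow> Q t x)" "sets (case p of (t, x) \<Rightarrow> Q t x) = sets borel"
    by (simp_all add: case_prod_beta subprob_Q)
next
  fix B :: "'a set" assume B: "B \<in> sets borel"
  have bb: "indicator B \<in> bounded_borel" by (rule bounded_borelI[of _ 1]) (use B in auto)
  have "(\<lambda>(t, x). measure (Q t x) B) \<in> borel_measurable (restrict_space lborel {0<..} \<Otimes>\<^sub>M borel)"
  proof (rule measurable_continuous_in_second_argument)
    fix x
    have "(\<lambda>t. emeasure (Q t x) B) \<in> borel_measurable (restrict_space (restrict_space borel {0..}) {0<..})"
      by (rule measurable_restrict_space1[OF measurable_Q_time[OF B]])
    also have "borel_measurable (restrict_space (restrict_space borel {0..}) {0<..})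
        = borel_measurable (restrict_space lborel {0::real<..})"
    proof (rule measurable_cong_sets)
      have "{0..} \<inter> {0<..} = {0::real<..}" by auto
      then show "sets (restrict_space (restrict_space borel {0..}) {0<..}) = sets (restrict_space lborel {0::real<..})"
        by (simp only: sets_restrict_restrict_space) (rule sets_restrict_space_cong, simp)
    qed simp
    finally show "(\<lambda>t. measure (Q t x) B) \<in> borel_measurable (restrict_space lborel {0<..})"
      unfolding measure_def by measurable
  next
    fix t assume "t \<in> space (restrict_space lborel {0::real<..})"
    then have t: "0 < t" by (simp add: space_restrict_space)
    then have eq: "(\<lambda>x. measure (Q t x) B) = (\<lambda>x. LINT y|Q t x. indicator B y)" using B by simp
    show "continuous_on UNIV (\<lambda>x. measure (Q t x) B)" unfolding eq by (rule feller[OF t bb])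
  qed
  then have "(\<lambda>p. ennreal (case p of (t, x) \<Rightarrow> measure (Q t x) B)) \<in> borel_measurable (restrict_space lborel {0<..} \<Otimes>\<^sub>M borel)"
    by measurable
  then show "(\<lambda>p. emeasure (case p of (t, x) \<Rightarrow> Q t x) B) \<in> borel_measurable (restrict_space lborel {0<..} \<Otimes>\<^sub>M borel)"
    by (rule measurable_cong[THEN iffD1, rotated])
       (auto simp: space_pair_measure space_restrict_space finite_measure.emeasure_eq_measure
         subprob_space.axioms(1)[OF subprob_Q])
qed

lemma measurable_Q_joint_nn:
  assumes f: "f \<in> borel_measurable borel"
  shows "(\<lambda>(t, x). \<integral>\<^sup>+y. f y \<partial>Q t x) \<in> borel_measurable (restrict_space lborel {0<..} \<Otimes>\<^sub>M borel)"
  using measurable_compose[OF measurable_Q_joint nn_integral_measurable_subprob_algebra[OF f]]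
  by (simp add: case_prod_beta)

lemma sigma_finite_halfline: "sigma_finite_measure (restrict_space lborel {0::real<..})"
  by (rule sigma_finite_measure_restrict_space) (auto intro: sigma_finite_lborel)

lemma measurable_integrand:
  assumes f: "f \<in> borel_measurable borel"
  shows "(\<lambda>(t, x). ennreal (exp (- t)) * (\<integral>\<^sup>+y. f y \<partial>Q t x))
    \<in> borel_measurable (restrict_space lborel {0<..} \<Otimes>\<^sub>M borel)"
proof -
  have "(\<lambda>t::real. t) \<in> borel_measurable (restrict_space lborel {0<..})"
    by (rule measurable_restrict_space1) simp
  then have [measurable]: "(\<lambda>p. fst p :: real) \<in> borel_measurable (restrict_space lborel {0<..} \<Otimes>\<^sub>M (borel :: 'a measure))"
    using measurable_compose[OF measurable_fst] by blast
  note [measurable] = measurable_Q_joint_nn[OF f, unfolded case_prod_beta]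
  show ?thesis unfolding case_prod_beta by measurable
qed

lemma resolvent_measurable:
  assumes f: "f \<in> borel_measurable borel"
  shows "resolvent f \<in> borel_measurable borel"
proof -
  interpret sigma_finite_measure "restrict_space lborel {0::real<..}" by (rule sigma_finite_halfline)
  show ?thesis
    unfolding resolvent_def
    using measurable_pair_swap[OF measurable_integrand[OF f]] by (intro borel_measurable_nn_integral) simp
qed

lemma integrand_measurable_time:
  "f \<in> borel_measurable borel \<Longrightarrow>
    (\<lambda>t. ennreal (exp (- t)) * (\<integral>\<^sup>+y. f y \<partial>Q t x)) \<in> borel_measurable (restrict_space lborel {0<..})"
  using measurable_Pair1[OF measurable_integrand, of f x] by simp

lemma resolvent_symmetric:
  assumes f: "f \<in> borel_measurable borel" and g: "g \<in> borel_measurable borel"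
  shows "(\<integral>\<^sup>+x. f x * resolvent g x \<partial>m) = (\<integral>\<^sup>+x. g x * resolvent f x \<partial>m)"
proof -
  let ?T = "restrict_space lborel {0::real<..}"
  interpret T: sigma_finite_measure ?T by (rule sigma_finite_halfline)
  interpret m: sigma_finite_measure m by (rule sigma_finite_m)
  interpret pair_sigma_finite ?T m ..
  have *: "(\<integral>\<^sup>+x. f x * resolvent g x \<partial>m) = (\<integral>\<^sup>+t. ennreal (exp (- t)) * (\<integral>\<^sup>+x. f x * (\<integral>\<^sup>+y. g y \<partial>Q t x) \<partial>m) \<partial>?T)"
    if f: "f \<in> borel_measurable borel" and g: "g \<in> borel_measurable borel" for f g
  proof -
    have [measurable]: "(\<lambda>(t, x). ennreal (exp (- t)) * (\<integral>\<^sup>+y. g y \<partial>Q t x)) \<in> borel_measurable (?T \<Otimes>\<^sub>M m)"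
      using measurable_integrand[OF g] measurable_cong_sets[OF sets_pair_measure_cong[OF refl sets_m] refl] by blast
    have [measurable]: "f \<in> borel_measurable m" using f by simp
    have "(\<integral>\<^sup>+x. f x * resolvent g x \<partial>m) = (\<integral>\<^sup>+x. (\<integral>\<^sup>+t. f x * (ennreal (exp (- t)) * (\<integral>\<^sup>+y. g y \<partial>Q t x)) \<partial>?T) \<partial>m)"
      unfolding resolvent_def using integrand_measurable_time[OF g] by (simp add: nn_integral_cmult)
    also have "\<dots> = (\<integral>\<^sup>+t. (\<integral>\<^sup>+x. f x * (ennreal (exp (- t)) * (\<integral>\<^sup>+y. g y \<partial>Q t x)) \<partial>m) \<partial>?T)"
      by (rule Fubini') measurable
    also have "\<dots> = (\<integral>\<^sup>+t. ennreal (exp (- t)) * (\<integral>\<^sup>+x. f x * (\<integral>\<^sup>+y. g y \<partial>Q t x) \<partial>m) \<partial>?T)"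
    proof (rule nn_integral_cong)
      fix t assume "t \<in> space ?T"
      then have "0 \<le> t" by (simp add: space_restrict_space)
      then show "(\<integral>\<^sup>+x. f x * (ennreal (exp (- t)) * (\<integral>\<^sup>+y. g y \<partial>Q t x)) \<partial>m)
          = ennreal (exp (- t)) * (\<integral>\<^sup>+x. f x * (\<integral>\<^sup>+y. g y \<partial>Q t x) \<partial>m)"
        using f nn_integral_Q_measurable[OF _ g, of t] by (simp add: nn_integral_cmult[symmetric] mult_ac)
    qed
    finally show ?thesis .
  qed
  show ?thesis
    unfolding *[OF f g] *[OF g f] using nn_symmetric[OF _ f g]
    by (intro nn_integral_cong) (simp add: space_restrict_space)
qed

lemma resolvent_mono: "(\<And>x. f x \<le> g x) \<Longrightarrow> resolvent f x \<le> resolvent g x"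
  unfolding resolvent_def by (intro nn_integral_mono mult_left_mono) auto

lemma resolvent_cmult:
  assumes f: "f \<in> borel_measurable borel"
  shows "resolvent (\<lambda>x. c * f x) x = c * resolvent f x"
proof -
  have "resolvent (\<lambda>x. c * f x) x
      = (\<integral>\<^sup>+t. c * (ennreal (exp (- t)) * (\<integral>\<^sup>+y. f y \<partial>Q t x)) \<partial>restrict_space lborel {0<..})"
    unfolding resolvent_def
    by (intro nn_integral_cong)
       (simp add: space_restrict_space nn_integral_cmult borel_measurable_Q[OF _ f] mult_ac)
  then show ?thesis by (simp add: resolvent_def nn_integral_cmult integrand_measurable_time[OF f])
qed

lemma resolvent_add:
  assumes f: "f \<in> borel_measurable borel" and g: "g \<in> borel_measurable borel"
  shows "resolvent (\<lambda>x. f x + g x) x = resolvent f x + resolvent g x"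
proof -
  have "resolvent (\<lambda>x. f x + g x) x
      = (\<integral>\<^sup>+t. ennreal (exp (- t)) * (\<integral>\<^sup>+y. f y \<partial>Q t x) + ennreal (exp (- t)) * (\<integral>\<^sup>+y. g y \<partial>Q t x) \<partial>restrict_space lborel {0<..})"
    unfolding resolvent_def
    by (intro nn_integral_cong)
       (simp add: space_restrict_space nn_integral_add borel_measurable_Q[OF _ f] borel_measurable_Q[OF _ g] distrib_left)
  then show ?thesis
    by (simp add: resolvent_def nn_integral_add integrand_measurable_time[OF f] integrand_measurable_time[OF g])
qed

lemma eigenfunction_resolvent:
  assumes f: "f \<in> borel_measurable borel" and c: "0 \<le> c"
    and eigen: "\<And>t. 0 < t \<Longrightarrow> (\<integral>\<^sup>+y. f y \<partial>Q t x) = ennreal (exp (- c * t)) * f x"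
  shows "f x = ennreal (1 + c) * resolvent f x"
proof -
  have "resolvent f x = (\<integral>\<^sup>+t. ennreal (exp (- (1 + c) * t)) * f x \<partial>restrict_space lborel {0<..})"
    unfolding resolvent_def
  proof (rule nn_integral_cong)
    fix t assume "t \<in> space (restrict_space lborel {0::real<..})"
    then have t: "0 < t" by (simp add: space_restrict_space)
    have "- t + - c * t = - (1 + c) * t" by (simp add: algebra_simps)
    then have "exp (- (1 + c) * t) = exp (- t) * exp (- c * t)" by (simp only: exp_add[symmetric])
    then show "ennreal (exp (- t)) * (\<integral>\<^sup>+y. f y \<partial>Q t x) = ennreal (exp (- (1 + c) * t)) * f x"
      by (simp only: eigen[OF t] ennreal_mult[OF exp_ge_zero exp_ge_zero] mult.assoc)
  qed
  also have "\<dots> = ennreal (1 / (1 + c)) * f x"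
  proof (subst nn_integral_multc)
    show "(\<lambda>t. ennreal (exp (- (1 + c) * t))) \<in> borel_measurable (restrict_space lborel {0<..})"
      by (rule measurable_restrict_space1) simp
  qed (use nn_integral_exp_halfline[of "1 + c"] c in simp)
  finally have "ennreal (1 + c) * resolvent f x = (ennreal (1 + c) * ennreal (1 / (1 + c))) * f x"
    by (simp only: mult.assoc)
  also have "ennreal (1 + c) * ennreal (1 / (1 + c)) = 1"
    using c by (subst ennreal_mult[symmetric]) auto
  finally show ?thesis by simp
qed

text \<open>Outside \<open>K\<close> the eigenfunction solves the fixed point equation
  \<open>tail = (1 + c) 1\<^sub>-\<^sub>K R (core + tail)\<close>, where \<open>core\<close> and \<open>tail\<close> are its parts on \<open>K\<close> and off \<open>K\<close>.
  Tightness makes the linear map \<open>f \<mapsto> (1 + c) 1\<^sub>-\<^sub>K R f\<close> a contraction with factor \<open>1/2\<close> in two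
  norms at once: on functions supported off \<open>K\<close> in the supremum norm, and, by symmetry of the resolvent,
  in \<open>L\<^sup>1\<close>. Iterating the equation from 0, the first property yields convergence to the bounded function
  \<open>tail\<close>, the second keeps the integrals of the iterates below \<open>G\<close>, the integral of \<open>core\<close>.
  Fatou's lemma then bounds the integral of \<open>tail\<close>.\<close>

theorem eigenfunction_integrable:
  assumes [measurable]: "\<phi> \<in> borel_measurable borel" and bound: "\<And>x. \<phi> x \<le> C" and c: "0 \<le> c"
    and eigen: "\<And>t x. 0 < t \<Longrightarrow> (\<integral>\<^sup>+y. ennreal (\<phi> y) \<partial>Q t x) = ennreal (exp (- c * t)) * ennreal (\<phi> x)"
    and K: "K \<in> sets borel" "emeasure m K < \<infinity>"
    and tight: "\<And>x. resolvent (indicator (- K)) x \<le> ennreal (1 / (2 * (1 + c)))"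
  shows "(\<integral>\<^sup>+x. ennreal (\<phi> x) \<partial>m) < \<infinity>"
proof -
  have K' [measurable]: "K \<in> sets borel" "- K \<in> sets borel" using K(1) by auto
  define core where "core x = indicator K x * ennreal (\<phi> x)" for x
  define tail where "tail x = indicator (- K) x * ennreal (\<phi> x)" for x
  have meas [measurable]: "core \<in> borel_measurable borel" "tail \<in> borel_measurable borel"
    unfolding core_def tail_def by measurable
  have split: "ennreal (\<phi> x) = core x + tail x" for x by (auto simp: core_def tail_def indicator_def)
  define G where "G = (\<integral>\<^sup>+x. core x \<partial>m)"
  have "G \<le> (\<integral>\<^sup>+x. ennreal C * indicator K x \<partial>m)"
    unfolding G_def core_def by (intro nn_integral_mono) (auto simp: indicator_def intro!: ennreal_leI bound)
  also have "\<dots> = ennreal C * emeasure m K" using K by (simp add: nn_integral_cmult_indicator)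
  also have "\<dots> < \<infinity>" using K by (simp add: ennreal_mult_less_top)
  finally have G: "G < \<infinity>" .
  have half: "ennreal (1 + c) * ennreal (1 / (2 * (1 + c))) = ennreal (1 / 2)"
  proof -
    have eq: "(1 + c) * (1 / (2 * (1 + c))) = 1 / 2" using c by (simp add: field_simps)
    have "ennreal (1 + c) * ennreal (1 / (2 * (1 + c))) = ennreal ((1 + c) * (1 / (2 * (1 + c))))"
      using c by (intro ennreal_mult[symmetric]) auto
    then show ?thesis unfolding eq .
  qed
  define F where "F = rec_nat (\<lambda>x. 0)
    (\<lambda>n f x. ennreal (1 + c) * (indicator (- K) x * resolvent (\<lambda>y. core y + f y) x))"
  have F0: "F 0 = (\<lambda>x. 0)" and F_Suc: "F (Suc n) = (\<lambda>x. ennreal (1 + c) * (indicator (- K) x * resolvent (\<lambda>y. core y + F n y) x))" for n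
    unfolding F_def by (rule nat.rec)+
  have F_meas [measurable]: "F n \<in> borel_measurable borel" for n
  proof (induction n)
    case (Suc n)
    then have "(\<lambda>y. core y + F n y) \<in> borel_measurable borel" by measurable
    note [measurable] = resolvent_measurable[OF this]
    show ?case unfolding F_Suc by measurable
  qed (simp add: F0)
  have F_int: "(\<integral>\<^sup>+x. F n x \<partial>m) \<le> G" for n
  proof (induction n)
    case (Suc n)
    have m: "(\<lambda>y. core y + F n y) \<in> borel_measurable borel" by measurable
    note [measurable] = resolvent_measurable[OF m]
    have "(\<integral>\<^sup>+x. F (Suc n) x \<partial>m) = ennreal (1 + c) * (\<integral>\<^sup>+x. indicator (- K) x * resolvent (\<lambda>y. core y + F n y) x \<partial>m)"
      unfolding F_Suc by (rule nn_integral_cmult) simp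
    also have "\<dots> = ennreal (1 + c) * (\<integral>\<^sup>+x. (core x + F n x) * resolvent (indicator (- K)) x \<partial>m)"
      by (subst resolvent_symmetric[OF _ m]) auto
    also have "\<dots> \<le> ennreal (1 + c) * (\<integral>\<^sup>+x. (core x + F n x) * ennreal (1 / (2 * (1 + c))) \<partial>m)"
      by (intro mult_left_mono nn_integral_mono tight) auto
    also have "(\<integral>\<^sup>+x. (core x + F n x) * ennreal (1 / (2 * (1 + c))) \<partial>m)
        = ennreal (1 / (2 * (1 + c))) * (G + (\<integral>\<^sup>+x. F n x \<partial>m))"
      unfolding G_def by (subst nn_integral_multc) (simp_all add: nn_integral_add mult.commute)
    also have "ennreal (1 + c) * \<dots> = ennreal (1 / 2) * (G + (\<integral>\<^sup>+x. F n x \<partial>m))"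
      unfolding half[symmetric] by (rule mult.assoc[symmetric])
    also have "\<dots> \<le> ennreal (1 / 2) * (G + G)"
      using Suc by (intro mult_left_mono add_left_mono) auto
    also have "\<dots> = (ennreal (1 / 2) * ennreal 2) * G"
      by (simp only: mult.assoc ennreal_numeral mult_2)
    also have "ennreal (1 / 2) * ennreal 2 = 1"
      by (subst ennreal_mult[symmetric]) auto
    also have "1 * G = G" by simp
    finally show ?case .
  qed (simp add: F0)
  have F_approx: "tail x \<le> F n x + ennreal C * ennreal ((1/2) ^ n) * indicator (- K) x" for n x
  proof (induction n arbitrary: x)
    case 0
    then show ?case by (auto simp: F0 tail_def indicator_def intro!: ennreal_leI bound)
  next
    case (Suc n)
    let ?d = "ennreal C * ennreal ((1/2) ^ n)"
    have "tail x = indicator (- K) x * (ennreal (1 + c) * resolvent (\<lambda>y. ennreal (\<phi> y)) x)"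
      unfolding tail_def by (subst eigenfunction_resolvent[OF _ c eigen]) auto
    also have "\<dots> \<le> indicator (- K) x * (ennreal (1 + c) * resolvent (\<lambda>y. (core y + F n y) + ?d * indicator (- K) y) x)"
      by (intro mult_left_mono resolvent_mono) (auto simp: split add.assoc intro!: add_left_mono Suc)
    also have "resolvent (\<lambda>y. (core y + F n y) + ?d * indicator (- K) y) x
        = resolvent (\<lambda>y. core y + F n y) x + ?d * resolvent (indicator (- K)) x"
    proof -
      have "resolvent (\<lambda>y. (core y + F n y) + ?d * indicator (- K) y) x
          = resolvent (\<lambda>y. core y + F n y) x + resolvent (\<lambda>y. ?d * indicator (- K) y) x"
        by (rule resolvent_add) auto
      also have "resolvent (\<lambda>y. ?d * indicator (- K) y) x = ?d * resolvent (indicator (- K)) x"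
        by (rule resolvent_cmult) auto
      finally show ?thesis .
    qed
    also have "indicator (- K) x * (ennreal (1 + c) * (resolvent (\<lambda>y. core y + F n y) x + ?d * resolvent (indicator (- K)) x))
        = F (Suc n) x + indicator (- K) x * (ennreal (1 + c) * (?d * resolvent (indicator (- K)) x))"
      unfolding F_Suc
      by (simp only: distrib_left mult.left_commute[of "indicator (- K) x" "ennreal (1 + c)"])
    also have "\<dots> \<le> F (Suc n) x + indicator (- K) x * (ennreal (1 + c) * (?d * ennreal (1 / (2 * (1 + c)))))"
      by (intro add_left_mono mult_left_mono tight) auto
    also have "ennreal (1 + c) * (?d * ennreal (1 / (2 * (1 + c)))) = ennreal C * (ennreal ((1/2) ^ n) * ennreal (1/2))"
      unfolding half[symmetric] by (simp add: mult_ac)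
    also have "ennreal ((1/2) ^ n) * ennreal (1/2) = ennreal ((1/2) ^ Suc n)"
      by (subst ennreal_mult[symmetric]) auto
    finally show ?case by (simp add: mult_ac)
  qed
  have "tail x \<le> liminf (\<lambda>n. F n x)" for x
  proof (rule ennreal_le_epsilon)
    fix e :: real assume e: "0 < e"
    have "(\<lambda>n. C * (1/2) ^ n) \<longlonglongrightarrow> C * 0" by (intro tendsto_intros LIMSEQ_power_zero) auto
    then have "\<forall>\<^sub>F n in sequentially. C * (1/2) ^ n < e" by (rule order_tendstoD) (use e in simp)
    then have "\<forall>\<^sub>F n in sequentially. tail x - ennreal e \<le> F n x"
    proof eventually_elim
      case (elim n)
      have "tail x \<le> F n x + ennreal C * ennreal ((1/2) ^ n) * 1"
        by (rule order_trans[OF F_approx[of x n]]) (auto intro!: add_left_mono mult_left_mono simp: indicator_def)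
      also have "\<dots> \<le> F n x + ennreal e"
        using elim by (auto simp: ennreal_mult''[symmetric] intro!: add_left_mono ennreal_leI)
      finally show ?case by (simp add: ennreal_minus_le_iff add.commute)
    qed
    then have "tail x - ennreal e \<le> liminf (\<lambda>n. F n x)" by (rule Liminf_bounded)
    then show "tail x \<le> liminf (\<lambda>n. F n x) + ennreal e" by (simp add: ennreal_minus_le_iff add.commute)
  qed
  then have "(\<integral>\<^sup>+x. tail x \<partial>m) \<le> (\<integral>\<^sup>+x. liminf (\<lambda>n. F n x) \<partial>m)" by (intro nn_integral_mono)
  also have "\<dots> \<le> liminf (\<lambda>n. \<integral>\<^sup>+x. F n x \<partial>m)" by (rule nn_integral_liminf) simp
  also have "\<dots> \<le> limsup (\<lambda>n. \<integral>\<^sup>+x. F n x \<partial>m)" by (rule Liminf_le_Limsup) simp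
  also have "\<dots> \<le> G" by (rule Limsup_bounded) (simp add: F_int)
  finally have "(\<integral>\<^sup>+x. ennreal (\<phi> x) \<partial>m) \<le> G + G"
    unfolding split by (simp add: nn_integral_add G_def[symmetric] add_left_mono)
  also have "\<dots> < \<infinity>" using G by simp
  finally show ?thesis .
qed

end

section \<open>Uniqueness of quasi-stationary distributions\<close>

lemma nn_integral_eq_imp_AE_eq:
  assumes [measurable]: "f \<in> borel_measurable M" "g \<in> borel_measurable M"
    and le: "AE x in M. f x \<le> g x" and int: "(\<integral>\<^sup>+x. g x \<partial>M) \<le> (\<integral>\<^sup>+x. f x \<partial>M)"
    and fin: "(\<integral>\<^sup>+x. f x \<partial>M) \<noteq> \<infinity>"
  shows "AE x in M. f x = g x"
proof -
  have "AE x in M. g x \<le> f x"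
  proof (rule ccontr)
    assume "\<not> (AE x in M. g x \<le> f x)"
    then have "(\<integral>\<^sup>+x. f x \<partial>M) < (\<integral>\<^sup>+x. g x \<partial>M)"
      using fin le by (intro nn_integral_less) auto
    with int show False by simp
  qed
  with le show ?thesis by eventually_elim auto
qed

context symmetric_semigroup
begin

lemma nn_integral_quasi_stationary:
  assumes t: "0 \<le> t" and \<nu>: "sets \<nu> = sets borel"
    and q: "\<And>B. B \<in> sets borel \<Longrightarrow> (\<integral>\<^sup>+x. emeasure (Q t x) B \<partial>\<nu>) = ennreal a * emeasure \<nu> B"
    and f: "f \<in> borel_measurable borel"
  shows "(\<integral>\<^sup>+x. (\<integral>\<^sup>+y. f y \<partial>Q t x) \<partial>\<nu>) = ennreal a * (\<integral>\<^sup>+x. f x \<partial>\<nu>)"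
proof -
  have sp: "space \<nu> = UNIV" using sets_eq_imp_space_eq[OF \<nu>] by simp
  have ker: "Q t \<in> \<nu> \<rightarrow>\<^sub>M subprob_algebra borel"
    using kernel[OF t] measurable_cong_sets[OF \<nu> refl] by blast
  have sets_eq: "sets (\<nu> \<bind> Q t) = sets borel"
    by (rule sets_bind) (use t sp in auto)
  have "\<nu> \<bind> Q t = scale_measure (ennreal a) \<nu>"
  proof (rule measure_eqI)
    show "sets (\<nu> \<bind> Q t) = sets (scale_measure (ennreal a) \<nu>)"
      by (simp add: \<nu> sets_eq)
    fix B assume "B \<in> sets (\<nu> \<bind> Q t)"
    then have B: "B \<in> sets borel" by (simp add: sets_eq)
    show "emeasure (\<nu> \<bind> Q t) B = emeasure (scale_measure (ennreal a) \<nu>) B"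
      using emeasure_bind[OF _ ker B] sp q[OF B] by simp
  qed
  moreover have "f \<in> borel_measurable \<nu>"
    using f measurable_cong_sets[OF \<nu> refl] by blast
  ultimately show ?thesis
    using nn_integral_bind[OF f ker] nn_integral_scale_measure[of f \<nu> "ennreal a"] by simp
qed

text \<open>By symmetry a null set is missed for almost every starting point, and by the strong Feller property
  for every one.\<close>

lemma null_set_not_charged:
  assumes t: "0 < t" and B: "B \<in> sets borel" and null: "emeasure m B = 0"
  shows "emeasure (Q t x) B = 0"
proof -
  have "(\<integral>\<^sup>+x. emeasure (Q t x) B \<partial>m) \<le> (\<integral>\<^sup>+x. indicator B x \<partial>m)"
    using nn_integral_Q_le[of t "indicator B"] t B by simp
  then have "(\<integral>\<^sup>+x. emeasure (Q t x) B \<partial>m) = 0" using null B by simp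
  then have ae: "AE x in m. emeasure (Q t x) B = 0"
    using nn_integral_Q_measurable[of t "indicator B"] t B by (subst (asm) nn_integral_0_iff_AE) auto
  have bb: "indicator B \<in> bounded_borel"
    by (rule bounded_borelI[of _ 1]) (use B in auto)
  have eq: "act t (indicator B) x = measure (Q t x) B" for x using t B by simp
  have "act t (indicator B) x = 0"
    by (rule continuous_AE_eqI[OF feller[OF t bb] continuous_on_const])
       (use ae in eventually_elim, simp only: eq measure_def, simp)
  then show ?thesis
    using subprob_space.axioms(1)[OF subprob_Q, of t x] t
    by (simp add: eq finite_measure.emeasure_eq_measure)
qed

definition irreducible :: bool where
  "irreducible \<longleftrightarrow> (\<forall>A \<in> sets borel.
     (\<forall>f \<in> L2 m \<inter> bounded_borel. \<forall>t>0.
        AE x in m. act t (\<lambda>y. indicator A y * f y) x = indicator A x * act t f x)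
     \<longrightarrow> emeasure m A = 0 \<or> emeasure m (- A) = 0)"

text \<open>If almost no mass enters \<open>A\<close> from outside then, by symmetry, almost none leaves \<open>A\<close>, so \<open>A\<close> is
  invariant.\<close>

lemma closed_set_trivial:
  assumes irr: irreducible and A: "A \<in> sets borel"
    and cl: "\<And>t. 0 < t \<Longrightarrow> AE x in m. x \<notin> A \<longrightarrow> emeasure (Q t x) A = 0"
  shows "emeasure m A = 0 \<or> emeasure m (- A) = 0"
proof -
  have "AE x in m. act t (\<lambda>y. indicator A y * f y) x = indicator A x * act t f x"
    if f: "f \<in> L2 m \<inter> bounded_borel" and t: "0 < t" for f t
  proof -
    have A': "- A \<in> sets borel" using A by auto
    have fm [measurable]: "f \<in> borel_measurable borel" using f by (auto simp: bounded_borel_def)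
    note [measurable] = A A'
    have m1: "(\<lambda>x. emeasure (Q t x) B) \<in> borel_measurable borel" if "B \<in> sets borel" for B
      using nn_integral_Q_measurable[of t "indicator B"] t that by simp
    note [measurable] = m1[OF A] m1[OF A']
    have "(\<integral>\<^sup>+x. indicator A x * emeasure (Q t x) (- A) \<partial>m) = (\<integral>\<^sup>+x. indicator (- A) x * emeasure (Q t x) A \<partial>m)"
      using nn_symmetric[of t "indicator A" "indicator (- A)"] t A A' by simp
    also have "\<dots> = 0"
      by (subst nn_integral_0_iff_AE) (use cl[OF t] in \<open>auto simp: indicator_def elim!: eventually_mono\<close>)
    finally have "AE x in m. indicator A x * emeasure (Q t x) (- A) = 0"
      by (subst (asm) nn_integral_0_iff_AE) auto
    with cl[OF t] show ?thesis
    proof eventually_elim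
      case (elim x)
      show ?case
      proof (cases "x \<in> A")
        case True
        with elim have "- A \<in> null_sets (Q t x)" using A' t by (auto simp: null_sets_def)
        then have "AE y in Q t x. y \<in> A" using AE_not_in by fastforce
        then have "act t (\<lambda>y. indicator A y * f y) x = act t f x"
          using A t by (intro integral_cong_AE) (auto intro!: borel_measurable_Q elim!: eventually_mono)
        with True show ?thesis by simp
      next
        case False
        with elim have "A \<in> null_sets (Q t x)" using A t by (auto simp: null_sets_def)
        then have "AE y in Q t x. y \<notin> A" by (rule AE_not_in)
        then have "act t (\<lambda>y. indicator A y * f y) x = (LINT y|Q t x. 0)"
          using A t by (intro integral_cong_AE) (auto intro!: borel_measurable_Q elim!: eventually_mono)
        with False show ?thesis by simp
      qed
    qed
  qed
  with irr A show ?thesis unfolding irreducible_def by blast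
qed

text \<open>Testing quasi-stationarity of \<open>\<nu>\<close> against \<open>\<psi>\<close> identifies the decay rate as that of \<open>\<psi>\<close>. Since
  \<open>\<nu>\<close> has a density \<open>h\<close>, both \<open>h\<close> and \<open>\<psi>\<close> are then integrable eigenfunctions with the same eigenvalue.
  Their minimum \<open>w\<close> satisfies \<open>p\<^sub>t w \<le> exp (- c t) w\<close>, and integrating against \<open>\<psi>\<close> shows equality. Hence
  \<open>\<psi> - w\<close> is a nonnegative eigenfunction, which vanishes exactly off \<open>A = {h < \<psi>}\<close>; so no mass
  enters \<open>A\<close>. By irreducibility \<open>h\<close> and \<open>\<psi>\<close> are comparable almost everywhere, and two comparable
  densities with the same integral agree.\<close>

theorem quasi_stationary_unique:
  assumes irr: irreducible
    and \<psi>_meas [measurable]: "\<psi> \<in> borel_measurable borel" and \<psi>_pos: "\<And>x. 0 < \<psi> x" and \<psi>_bound: "\<And>x. \<psi> x \<le> C"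
    and \<psi>_int: "(\<integral>\<^sup>+x. ennreal (\<psi> x) \<partial>m) = 1"
    and eigen: "\<And>t x. 0 < t \<Longrightarrow> (\<integral>\<^sup>+y. ennreal (\<psi> y) \<partial>Q t x) = ennreal (exp (- c * t)) * ennreal (\<psi> x)"
    and \<nu>: "prob_space \<nu>" "sets \<nu> = sets borel"
    and qs: "\<And>t B. 0 < t \<Longrightarrow> B \<in> sets borel \<Longrightarrow>
      (\<integral>\<^sup>+x. emeasure (Q t x) B \<partial>\<nu>) = ennreal (a t) * emeasure \<nu> B"
    and a_pos: "\<And>t. 0 < t \<Longrightarrow> 0 < a t"
  shows "\<nu> = density m (\<lambda>x. ennreal (\<psi> x))"
proof -
  interpret \<nu>: prob_space \<nu> by (rule \<nu>(1))
  interpret m: sigma_finite_measure m by (rule sigma_finite_m)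
  have [measurable_cong]: "sets \<nu> = sets borel" by (rule \<nu>(2))
  have sp [simp]: "space \<nu> = UNIV" using sets_eq_imp_space_eq[OF \<nu>(2)] by simp
  define e where "e t = ennreal (exp (- c * t))" for t
  have e: "e t \<noteq> \<infinity>" "e t \<noteq> 0" for t by (auto simp: e_def)
  have nu_Q: "(\<integral>\<^sup>+x. (\<integral>\<^sup>+y. f y \<partial>Q t x) \<partial>\<nu>) = ennreal (a t) * (\<integral>\<^sup>+x. f x \<partial>\<nu>)"
    if "0 < t" "f \<in> borel_measurable borel" for f t
    by (rule nn_integral_quasi_stationary) (use that \<nu> qs in auto)

  have a_eq: "ennreal (a t) = e t" if t: "0 < t" for t
  proof -
    have fin: "(\<integral>\<^sup>+x. ennreal (\<psi> x) \<partial>\<nu>) \<noteq> \<infinity>"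
    proof -
      have "(\<integral>\<^sup>+x. ennreal (\<psi> x) \<partial>\<nu>) \<le> (\<integral>\<^sup>+x. ennreal C \<partial>\<nu>)"
        by (intro nn_integral_mono ennreal_leI \<psi>_bound)
      also have "\<dots> < \<infinity>" using \<nu>.emeasure_space_1 by simp
      finally show ?thesis by simp
    qed
    have nz: "(\<integral>\<^sup>+x. ennreal (\<psi> x) \<partial>\<nu>) \<noteq> 0"
    proof
      assume "(\<integral>\<^sup>+x. ennreal (\<psi> x) \<partial>\<nu>) = 0"
      then have "AE x in \<nu>. ennreal (\<psi> x) = 0" by (subst (asm) nn_integral_0_iff_AE) auto
      then have "AE x in \<nu>. False"
        by eventually_elim (use \<psi>_pos in \<open>metis ennreal_eq_0_iff not_le\<close>)
      then show False using \<nu>.AE_False by simp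
    qed
    have "e t * (\<integral>\<^sup>+x. ennreal (\<psi> x) \<partial>\<nu>) = ennreal (a t) * (\<integral>\<^sup>+x. ennreal (\<psi> x) \<partial>\<nu>)"
      using nu_Q[OF t, of "\<lambda>x. ennreal (\<psi> x)"] t by (simp add: eigen[OF t] e_def nn_integral_cmult)
    then show ?thesis using fin nz by (auto simp: mult.commute[of _ "integral\<^sup>N \<nu> _"] ennreal_mult_cancel_left)
  qed

  have "absolutely_continuous m \<nu>"
    unfolding absolutely_continuous_def
  proof
    fix B assume "B \<in> null_sets m"
    then have B: "B \<in> sets borel" "emeasure m B = 0" by auto
    have "ennreal (a 1) * emeasure \<nu> B = 0"
      using qs[of 1 B] null_set_not_charged[OF _ B] B by simp
    then show "B \<in> null_sets \<nu>" using B a_pos[of 1] by (auto simp: null_sets_def ennreal_eq_0_iff)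
  qed
  define h where "h = RN_deriv m \<nu>"
  have h_meas [measurable]: "h \<in> borel_measurable borel"
    using borel_measurable_RN_deriv[of m \<nu>] measurable_cong_sets[OF sets_m refl] by (auto simp: h_def)
  have h: "density m h = \<nu>"
    unfolding h_def by (rule m.density_RN_deriv) (use \<open>absolutely_continuous m \<nu>\<close> \<nu>(2) in auto)
  have int_nu: "(\<integral>\<^sup>+x. f x \<partial>\<nu>) = (\<integral>\<^sup>+x. h x * f x \<partial>m)" if "f \<in> borel_measurable borel" for f
    unfolding h[symmetric] by (rule nn_integral_density) (use that in auto)
  have h_int: "(\<integral>\<^sup>+x. h x \<partial>m) = 1"
    using int_nu[of "\<lambda>_. 1"] \<nu>.emeasure_space_1 by simp

  define w where "w x = min (h x) (ennreal (\<psi> x))" for x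
  have w_meas [measurable]: "w \<in> borel_measurable borel" unfolding w_def by measurable
  define A where "A = {x. h x < ennreal (\<psi> x)}"
  have A [measurable]: "A \<in> sets borel" unfolding A_def by measurable
  have closed: "AE x in m. x \<notin> A \<longrightarrow> emeasure (Q t x) A = 0" if t: "0 < t" for t
  proof -
    define W where "W x = (\<integral>\<^sup>+y. w y \<partial>Q t x)" for x
    have W_meas [measurable]: "W \<in> borel_measurable borel"
      unfolding W_def by (rule nn_integral_Q_measurable) (use t in auto)
    have W_le_\<psi>: "W x \<le> e t * ennreal (\<psi> x)" for x
      unfolding W_def eigen[OF t, folded e_def, symmetric] by (rule nn_integral_mono) (simp add: w_def)
    \<comment> \<open>\<open>h\<close> may be unbounded, so its eigenvalue relation is used in weak form, through \<open>\<nu>\<close>, on the set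
      \<open>N\<close> where the claim fails.\<close>
    have W_le_h: "AE x in m. W x \<le> e t * h x"
    proof -
      define N where "N = {x. e t * h x < W x}"
      have N [measurable]: "N \<in> sets borel" unfolding N_def by measurable
      have "(\<integral>\<^sup>+x. indicator N x * W x \<partial>m) = (\<integral>\<^sup>+x. w x * (\<integral>\<^sup>+y. indicator N y \<partial>Q t x) \<partial>m)"
        unfolding W_def by (rule nn_symmetric) (use t in auto)
      also have "\<dots> \<le> (\<integral>\<^sup>+x. h x * (\<integral>\<^sup>+y. indicator N y \<partial>Q t x) \<partial>m)"
        by (intro nn_integral_mono mult_right_mono) (auto simp: w_def)
      also have "\<dots> = (\<integral>\<^sup>+x. (\<integral>\<^sup>+y. indicator N y \<partial>Q t x) \<partial>\<nu>)"
        by (rule int_nu[symmetric], rule nn_integral_Q_measurable) (use t in auto)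
      also have "\<dots> = e t * (\<integral>\<^sup>+x. indicator N x \<partial>\<nu>)"
        using nu_Q[OF t, of "indicator N"] a_eq[OF t] by simp
      also have "\<dots> = (\<integral>\<^sup>+x. indicator N x * (e t * h x) \<partial>m)"
        by (subst int_nu) (auto simp: nn_integral_cmult[symmetric] mult_ac)
      finally have le: "(\<integral>\<^sup>+x. indicator N x * W x \<partial>m) \<le> (\<integral>\<^sup>+x. indicator N x * (e t * h x) \<partial>m)" .
      have "(\<integral>\<^sup>+x. indicator N x * (e t * h x) \<partial>m) \<le> (\<integral>\<^sup>+x. e t * h x \<partial>m)"
        by (intro nn_integral_mono) (auto simp: indicator_def)
      also have "\<dots> = e t" by (simp add: nn_integral_cmult h_int)
      finally have fin: "(\<integral>\<^sup>+x. indicator N x * (e t * h x) \<partial>m) \<noteq> \<infinity>"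
        using e[of t] by (auto simp: top_unique)
      have "AE x in m. indicator N x * (e t * h x) = indicator N x * W x"
        by (rule nn_integral_eq_imp_AE_eq[OF _ _ _ le fin]) (auto simp: N_def indicator_def)
      then show ?thesis
      proof eventually_elim
        case (elim x)
        then show ?case by (cases "e t * h x < W x") (auto simp: N_def)
      qed
    qed
    have W_le: "AE x in m. W x \<le> e t * w x"
      using W_le_h by eventually_elim (use W_le_\<psi> in \<open>auto simp: w_def min_def\<close>)
    have "(\<integral>\<^sup>+x. ennreal (\<psi> x) * W x \<partial>m) = (\<integral>\<^sup>+x. w x * (\<integral>\<^sup>+y. ennreal (\<psi> y) \<partial>Q t x) \<partial>m)"
      unfolding W_def by (rule nn_symmetric) (use t in auto)
    also have "\<dots> = (\<integral>\<^sup>+x. ennreal (\<psi> x) * (e t * w x) \<partial>m)"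
      by (simp add: eigen[OF t] e_def mult_ac)
    finally have int_eq: "(\<integral>\<^sup>+x. ennreal (\<psi> x) * W x \<partial>m) = (\<integral>\<^sup>+x. ennreal (\<psi> x) * (e t * w x) \<partial>m)" .
    have "(\<integral>\<^sup>+x. ennreal (\<psi> x) * W x \<partial>m) \<le> (\<integral>\<^sup>+x. (ennreal C * e t) * ennreal (\<psi> x) \<partial>m)"
    proof (intro nn_integral_mono)
      fix x
      have "ennreal (\<psi> x) * W x \<le> ennreal C * (e t * ennreal (\<psi> x))"
        by (intro mult_mono W_le_\<psi> ennreal_leI \<psi>_bound) auto
      then show "ennreal (\<psi> x) * W x \<le> (ennreal C * e t) * ennreal (\<psi> x)" by (simp add: mult_ac)
    qed
    also have "\<dots> = ennreal C * e t" by (simp add: nn_integral_cmult \<psi>_int)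
    finally have fin: "(\<integral>\<^sup>+x. ennreal (\<psi> x) * W x \<partial>m) \<noteq> \<infinity>"
      using e[of t] by (auto simp: top_unique ennreal_mult_eq_top_iff)
    have "AE x in m. ennreal (\<psi> x) * W x = ennreal (\<psi> x) * (e t * w x)"
      by (rule nn_integral_eq_imp_AE_eq[OF _ _ _ _ fin])
         (use W_le int_eq in \<open>auto elim!: eventually_mono intro!: mult_left_mono\<close>)
    then show ?thesis
    proof eventually_elim
      case (elim x)
      show ?case
      proof
        assume "x \<notin> A"
        then have "w x = ennreal (\<psi> x)" by (auto simp: A_def w_def)
        moreover have "W x = e t * w x"
          using elim \<psi>_pos[of x] by (auto simp: ennreal_mult_cancel_left ennreal_eq_0_iff)
        ultimately have W: "W x = e t * ennreal (\<psi> x)" by simp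
        define u where "u y = ennreal (\<psi> y) - w y" for y
        have u_meas [measurable]: "u \<in> borel_measurable borel" unfolding u_def by measurable
        have uw: "ennreal (\<psi> y) = u y + w y" for y
          by (simp add: u_def w_def diff_add_cancel_ennreal)
        have "e t * ennreal (\<psi> x) = (\<integral>\<^sup>+y. u y + w y \<partial>Q t x)"
          using eigen[OF t, of x] by (simp add: e_def uw[symmetric])
        also have "\<dots> = (\<integral>\<^sup>+y. u y \<partial>Q t x) + W x"
          unfolding W_def using t by (intro nn_integral_add borel_measurable_Q) auto
        finally have "(\<integral>\<^sup>+y. u y \<partial>Q t x) = 0"
          unfolding W using e[of t] ennreal_add_left_cancel[of "e t * ennreal (\<psi> x)" 0]
          by (auto simp: add.commute ennreal_mult_eq_top_iff)
        then have "emeasure (Q t x) {y \<in> space (Q t x). u y \<noteq> 0} = 0"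
          using t by (subst (asm) nn_integral_0_iff) (auto intro!: borel_measurable_Q)
        moreover have "{y \<in> space (Q t x). u y \<noteq> 0} = A"
          using t by (auto simp: A_def u_def w_def min_def diff_eq_0_iff_ennreal)
        ultimately show "emeasure (Q t x) A = 0" by simp
      qed
    qed
  qed
  have "emeasure m A = 0 \<or> emeasure m (- A) = 0"
    by (rule closed_set_trivial[OF irr A closed])
  then have "AE x in m. h x = ennreal (\<psi> x)"
  proof
    assume "emeasure m A = 0"
    then have "AE x in m. ennreal (\<psi> x) \<le> h x"
      using AE_iff_measurable[of A m "\<lambda>x. ennreal (\<psi> x) \<le> h x"] by (auto simp: A_def not_le)
    from nn_integral_eq_imp_AE_eq[OF _ _ this] show ?thesis
      by (auto simp: h_int \<psi>_int elim!: eventually_mono)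
  next
    assume "emeasure m (- A) = 0"
    then have "AE x in m. h x < ennreal (\<psi> x)"
      using AE_iff_measurable[of "- A" m "\<lambda>x. h x < ennreal (\<psi> x)"] by (auto simp: A_def)
    then have "AE x in m. h x \<le> ennreal (\<psi> x)" by eventually_elim simp
    from nn_integral_eq_imp_AE_eq[OF _ _ this] show ?thesis
      by (auto simp: h_int \<psi>_int elim!: eventually_mono)
  qed
  then have "density m h = density m (\<lambda>x. ennreal (\<psi> x))"
    by (intro density_cong) auto
  then show ?thesis by (simp add: h)
qed

end

section \<open>Ground states of Markov processes in Class (T)\<close>

context markov_process
begin

text \<open>Exchanging the expectation with the time integral identifies the probabilistic resolvent with the
  one built from the kernels. The uniform bound makes the supremum in the tightness condition a genuine
  one.\<close>

lemma ennreal_resolvent_op_eq: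
  fixes f :: "'a \<Rightarrow> real"
  assumes [measurable]: "f \<in> borel_measurable borel" and f: "\<And>y. 0 \<le> f y" "\<And>y. f y \<le> 1"
  shows "ennreal (resolvent_op X P 1 f x)
      = (\<integral>\<^sup>+t. ennreal (exp (- t)) * (\<integral>\<^sup>+y. ennreal (f y) \<partial>transition t x) \<partial>restrict_space lborel {0<..})"
    and "resolvent_op X P 1 f x \<le> 1"
proof -
  let ?T = "restrict_space lborel {0::real..}" and ?P = "P (Some x)"
  interpret P: prob_space ?P by (rule prob_space_P)
  interpret T: sigma_finite_measure ?T
    by (rule sigma_finite_measure_restrict_space) (auto intro: sigma_finite_lborel)
  interpret pair_sigma_finite ?T ?P ..
  define h where "h t \<omega> = exp (- t) * extend0 f (X t \<omega>)" for t \<omega>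
  have extend: "0 \<le> extend0 f z" "extend0 f z \<le> 1" for z
    using f by (auto simp: extend0_def split: option.splits)
  have h: "0 \<le> h t \<omega>" "h t \<omega> \<le> exp (- t)" for t \<omega>
    using extend[of "X t \<omega>"] mult_left_le[of "extend0 f (X t \<omega>)" "exp (- t)"] by (auto simp: h_def)
  have sets_T: "sets ?T = sets (restrict_space borel {0..})"
    by (rule sets_restrict_space_cong) simp
  have [measurable]: "(\<lambda>(t, \<omega>). X t \<omega>) \<in> ?T \<Otimes>\<^sub>M ?P \<rightarrow>\<^sub>M cemetery_borel"
    using measurable_X measurable_cong_sets[OF sets_pair_measure_cong[OF sets_T sets_P] refl] by blast
  have [measurable]: "extend0 f \<in> borel_measurable cemetery_borel"
    unfolding extend0_eq_case_option by (rule measurable_case_option_cemetery) auto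
  have id_T [measurable]: "(\<lambda>t. t) \<in> borel_measurable ?T"
    by (rule measurable_restrict_space1) simp
  have [measurable]: "(\<lambda>p. fst p :: real) \<in> borel_measurable (?T \<Otimes>\<^sub>M ?P)"
    by (rule measurable_compose[OF measurable_fst id_T])
  have h_meas [measurable]: "(\<lambda>(t, \<omega>). h t \<omega>) \<in> borel_measurable (?T \<Otimes>\<^sub>M ?P)"
    unfolding h_def case_prod_beta
    by measurable
  define I where "I \<omega> = (LINT t|?T. h t \<omega>)" for \<omega>
  have op: "resolvent_op X P 1 f x = (LINT \<omega>|?P. I \<omega>)"
  proof -
    have "(LINT t:{0..}|lborel. exp (- 1 * t) * extend0 f (X t \<omega>)) = I \<omega>" for \<omega>
      unfolding I_def h_def set_lebesgue_integral_def by (subst integral_restrict_space) simp_all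
    then show ?thesis by (simp add: resolvent_op_def)
  qed
  have exp_int: "(\<integral>\<^sup>+t. ennreal (exp (- t)) \<partial>?T) = 1"
    using nn_integral_exp_halfline[of 1] by (simp add: nn_integral_halfline_closed_eq_open)
  have I: "ennreal (I \<omega>) = (\<integral>\<^sup>+t. ennreal (h t \<omega>) \<partial>?T)" "0 \<le> I \<omega>" "I \<omega> \<le> 1" if "\<omega> \<in> space M" for \<omega>
  proof -
    have [measurable]: "(\<lambda>t. h t \<omega>) \<in> borel_measurable ?T"
      using measurable_Pair1[OF h_meas, of \<omega>] that by simp
    have le: "(\<integral>\<^sup>+t. ennreal (h t \<omega>) \<partial>?T) \<le> 1"
      unfolding exp_int[symmetric] by (intro nn_integral_mono ennreal_leI h)
    have "integrable ?T (\<lambda>t. h t \<omega>)"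
      using h(1) le by (intro integrableI_nonneg) (auto intro: le_less_trans)
    then show eq: "ennreal (I \<omega>) = (\<integral>\<^sup>+t. ennreal (h t \<omega>) \<partial>?T)"
      unfolding I_def by (intro nn_integral_eq_integral[symmetric]) (auto simp: h)
    show "0 \<le> I \<omega>" unfolding I_def by (intro integral_nonneg_AE) (simp add: h)
    show "I \<omega> \<le> 1" using le unfolding eq[symmetric] by simp
  qed
  have [measurable]: "I \<in> borel_measurable ?P"
    unfolding I_def using measurable_pair_swap[OF h_meas] by (intro T.borel_measurable_lebesgue_integral) simp
  have I_int: "integrable ?P I"
    by (rule P.integrable_const_bound[of _ 1]) (use I in \<open>auto intro!: AE_I2\<close>)
  have "ennreal (resolvent_op X P 1 f x) = (\<integral>\<^sup>+\<omega>. ennreal (I \<omega>) \<partial>?P)"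
    unfolding op by (rule nn_integral_eq_integral[symmetric, OF I_int]) (use I in auto)
  also have "\<dots> = (\<integral>\<^sup>+\<omega>. (\<integral>\<^sup>+t. ennreal (h t \<omega>) \<partial>?T) \<partial>?P)"
    by (intro nn_integral_cong) (simp add: I)
  also have "\<dots> = (\<integral>\<^sup>+t. (\<integral>\<^sup>+\<omega>. ennreal (h t \<omega>) \<partial>?P) \<partial>?T)"
    by (rule Fubini') measurable
  also have "\<dots> = (\<integral>\<^sup>+t. ennreal (exp (- t)) * (\<integral>\<^sup>+y. ennreal (f y) \<partial>transition t x) \<partial>?T)"
  proof (rule nn_integral_cong)
    fix t assume "t \<in> space ?T"
    then have t: "0 \<le> t" by (simp add: space_restrict_space)
    have [measurable]: "X t \<in> ?P \<rightarrow>\<^sub>M cemetery_borel" by (rule measurable_X_at_P[OF t])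
    have "(\<integral>\<^sup>+\<omega>. ennreal (h t \<omega>) \<partial>?P) = (\<integral>\<^sup>+\<omega>. ennreal (exp (- t)) * ennreal (extend0 f (X t \<omega>)) \<partial>?P)"
      by (simp add: h_def ennreal_mult extend)
    also have "\<dots> = ennreal (exp (- t)) * (\<integral>\<^sup>+\<omega>. ennreal (extend0 f (X t \<omega>)) \<partial>?P)"
      by (rule nn_integral_cmult) measurable
    also have "(\<integral>\<^sup>+\<omega>. ennreal (extend0 f (X t \<omega>)) \<partial>?P) = (\<integral>\<^sup>+y. ennreal (f y) \<partial>transition t x)"
      by (subst nn_integral_transition_kernel[OF t]) (auto simp: extend0_def intro!: nn_integral_cong split: option.splits)
    finally show "(\<integral>\<^sup>+\<omega>. ennreal (h t \<omega>) \<partial>?P) = ennreal (exp (- t)) * (\<integral>\<^sup>+y. ennreal (f y) \<partial>transition t x)" .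
  qed
  also have "\<dots> = (\<integral>\<^sup>+t. ennreal (exp (- t)) * (\<integral>\<^sup>+y. ennreal (f y) \<partial>transition t x) \<partial>restrict_space lborel {0<..})"
    by (rule nn_integral_halfline_closed_eq_open)
  finally show "ennreal (resolvent_op X P 1 f x)
      = (\<integral>\<^sup>+t. ennreal (exp (- t)) * (\<integral>\<^sup>+y. ennreal (f y) \<partial>transition t x) \<partial>restrict_space lborel {0<..})" .
  have "(LINT \<omega>|?P. I \<omega>) \<le> (LINT \<omega>|?P. 1)"
    by (intro integral_mono I_int) (use I in auto)
  then show "resolvent_op X P 1 f x \<le> 1"
    using op P.prob_space by simp
qed

lemma ennreal_initial_prob:
  assumes t: "0 \<le> t" and B: "B \<in> sets borel" and \<nu>: "prob_space \<nu>" "sets \<nu> = sets borel"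
  shows "ennreal (initial_prob P \<nu> {\<omega> \<in> space M. X t \<omega> \<in> Some ` B}) = (\<integral>\<^sup>+x. emeasure (transition t x) B \<partial>\<nu>)"
proof -
  interpret \<nu>: prob_space \<nu> by (rule \<nu>(1))
  let ?g = "\<lambda>x. measure (P (Some x)) {\<omega> \<in> space M. X t \<omega> \<in> Some ` B}"
  have "?g \<in> borel_measurable borel"
    by (rule measurable_compose[OF measurable_Some_cemetery measurable_transition[OF t image_Some_in_cemetery_borel[OF B]]])
  then have [measurable]: "?g \<in> borel_measurable \<nu>"
    using measurable_cong_sets[OF \<nu>(2) refl] by blast
  have "integrable \<nu> ?g"
    by (rule \<nu>.integrable_const_bound[of _ 1]) (auto simp: prob_space.prob_le_1[OF prob_space_P])
  then have "ennreal (initial_prob P \<nu> {\<omega> \<in> space M. X t \<omega> \<in> Some ` B}) = (\<integral>\<^sup>+x. ennreal (?g x) \<partial>\<nu>)"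
    unfolding initial_prob_def by (intro nn_integral_eq_integral[symmetric]) auto
  then show ?thesis
    by (simp add: emeasure_transition_kernel[OF t B] prob_space.finite_measure[OF prob_space_P] finite_measure.emeasure_eq_measure)
qed

end

text \<open>Level sets of a positive square-integrable function have finite measure by Markov's inequality and
  exhaust the space.\<close>

lemma sigma_finite_if_positive_L2:
  assumes u: "u \<in> L2 m" and pos: "\<And>x. 0 < u x"
  shows "sigma_finite_measure m"
proof
  have [measurable]: "u \<in> borel_measurable m" and int: "integrable m (\<lambda>x. (u x)\<^sup>2)"
    using u by (auto simp: L2_def)
  define A where "A n = {x \<in> space m. 1 \<le> ennreal (real n) * ennreal ((u x)\<^sup>2)}" for n :: nat
  have "(\<Union>n. A n) = space m"
  proof safe
    fix x assume x: "x \<in> space m"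
    have "0 < (u x)\<^sup>2" using pos[of x] by simp
    then obtain n where "1 < real n * (u x)\<^sup>2" using reals_Archimedean3 by blast
    then have "1 \<le> ennreal (real n * (u x)\<^sup>2)" by (simp add: ennreal_leI flip: ennreal_1)
    then show "x \<in> (\<Union>n. A n)" using x by (auto simp: A_def ennreal_mult)
  qed (auto simp: A_def)
  moreover have "emeasure m (A n) \<noteq> \<infinity>" for n
  proof -
    have "emeasure m (A n) \<le> ennreal (real n) * (\<integral>\<^sup>+x. ennreal ((u x)\<^sup>2) * indicator (space m) x \<partial>m)"
      unfolding A_def by (rule nn_integral_Markov_inequality) auto
    also have "(\<integral>\<^sup>+x. ennreal ((u x)\<^sup>2) * indicator (space m) x \<partial>m) = (\<integral>\<^sup>+x. ennreal ((u x)\<^sup>2) \<partial>m)"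
      by (intro nn_integral_cong) simp
    also have "ennreal (real n) * \<dots> < \<infinity>"
      using int by (simp add: integrable_iff_bounded ennreal_mult_less_top)
    finally show ?thesis by simp
  qed
  moreover have "range A \<subseteq> sets m" unfolding A_def by auto
  ultimately show "\<exists>A. countable A \<and> A \<subseteq> sets m \<and> \<Union>A = space m \<and> (\<forall>a\<in>A. emeasure m a \<noteq> \<infinity>)"
    by (intro exI[of _ "range A"]) auto
qed

theorem theorem3p1:
  fixes m :: "'a::{metric_space, second_countable_topology} measure"
    and M :: "'w measure"
    and X :: "real \<Rightarrow> 'w \<Rightarrow> 'a option"
    and P :: "'a option \<Rightarrow> 'w measure"
    and \<phi>\<^sub>0 :: "'a \<Rightarrow> real"
  assumes "locally_compact_space (euclidean :: 'a topology)"
    and "radon_measure m"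
    and "full_topological_support m"
    and "markov_process M X P"
    and "m_symmetric m X P"
    and "explosive X P"
    and "class_T m X P"
    and "ground_state m X P \<phi>\<^sub>0"
    and "\<phi>\<^sub>0 \<in> bounded_cont"
    and "\<And>x. \<phi>\<^sub>0 x > 0"
  shows "quasi_stationary M X P (normalized_measure m \<phi>\<^sub>0) \<and>
         (\<forall>\<nu>. quasi_stationary M X P \<nu> \<longrightarrow> \<nu> = normalized_measure m \<phi>\<^sub>0)"
proof -
  note pos = \<open>\<And>x. \<phi>\<^sub>0 x > 0\<close>
  then have nonneg [simp]: "0 \<le> \<phi>\<^sub>0 x" for x by (rule less_imp_le)
  interpret markov_process M X P by (rule assms)
  have irr: "irreducible_process m X P" and sf: "strong_feller X P" and tight: "tight_process X P"
    using \<open>class_T m X P\<close> by (auto simp: class_T_def)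
  have sets_m: "sets m = sets borel" and compact_finite: "\<And>K. compact K \<Longrightarrow> emeasure m K < \<infinity>"
    using \<open>radon_measure m\<close> by (auto simp: radon_measure_def)
  have dom: "\<phi>\<^sub>0 \<in> form_domain m X P" and norm: "L2_norm m \<phi>\<^sub>0 = 1"
    and min: "dirichlet_form m X P \<phi>\<^sub>0 \<phi>\<^sub>0 = spectral_bottom m X P"
    using \<open>ground_state m X P \<phi>\<^sub>0\<close> by (auto simp: ground_state_def)
  have L2: "\<phi>\<^sub>0 \<in> L2 m" using dom by (simp add: form_domain_def)
  have cont: "continuous_on UNIV \<phi>\<^sub>0" using \<open>\<phi>\<^sub>0 \<in> bounded_cont\<close> by (simp add: bounded_cont_def)
  then have meas [measurable]: "\<phi>\<^sub>0 \<in> borel_measurable borel" by (rule borel_measurable_continuous_onI)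
  have bb: "\<phi>\<^sub>0 \<in> bounded_borel"
    using meas \<open>\<phi>\<^sub>0 \<in> bounded_cont\<close> by (simp add: bounded_borel_def bounded_cont_def)

  have feller: "continuous_on UNIV (\<lambda>x. LINT y|transition t x. f y)" if "0 < t" "f \<in> bounded_borel" for t f
  proof -
    have "semigroup_op X P t f \<in> bounded_cont" using sf that by (auto simp: strong_feller_def)
    then have cont: "continuous_on UNIV (semigroup_op X P t f)" by (simp add: bounded_cont_def)
    have eq: "(\<lambda>x. LINT y|transition t x. f y) = semigroup_op X P t f"
      using that by (intro ext integral_transition_kernel) (auto simp: bounded_borel_def)
    show ?thesis unfolding eq by (rule cont)
  qed
  have symm: "(LINT x|m. (LINT y|transition t x. f y) * g x) = (LINT x|m. f x * (LINT y|transition t x. g y))"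
    if "0 < t" "f \<in> L2 m \<inter> bounded_borel" "g \<in> L2 m \<inter> bounded_borel" for t f g
    using \<open>m_symmetric m X P\<close> that by (simp add: m_symmetric_def integral_transition_kernel bounded_borel_def)
  interpret S: symmetric_semigroup m transition
  proof (rule symmetric_semigroup.intro)
    show "sigma_finite_measure m" by (rule sigma_finite_if_positive_L2[OF L2 pos])
  qed (use sets_m \<open>full_topological_support m\<close> measurable_transition_kernel transition_0 emeasure_transition_kernel_add symm feller
        measurable_transition_kernel_time in auto)
  have act: "S.act t u x = semigroup_op X P t u x" if "0 \<le> t" "u \<in> borel_measurable borel" for t u x
    using that by (rule integral_transition_kernel)
  have L2_meas: "u \<in> borel_measurable borel" if "u \<in> L2 m" for u
    using that measurable_cong_sets[OF sets_m refl] by (auto simp: L2_def)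
  have approx: "1 / t * (LINT x|m. (u x - S.act t u x) * u x) = approx_form m X P t u u"
    if "0 \<le> t" "u \<in> L2 m" for t u
    unfolding approx_form_def L2_inner_def act[OF that(1) L2_meas[OF that(2)]] ..
  have approx_lim: "((\<lambda>t. 1 / t * (LINT x|m. (u x - S.act t u x) * u x)) \<longlongrightarrow> l) (at_right 0)
      \<longleftrightarrow> ((\<lambda>t. approx_form m X P t u u) \<longlongrightarrow> l) (at_right 0)" if "u \<in> L2 m" for u l
    by (rule tendsto_cong) (use eventually_at_right_less[of "0::real"] approx[OF _ that] in \<open>auto elim!: eventually_mono\<close>)
  have form_eq: "dirichlet_form m X P u u = l" if "((\<lambda>t. approx_form m X P t u u) \<longlongrightarrow> l) (at_right 0)" for u l
    unfolding dirichlet_form_def by (rule tendsto_Lim[OF _ that]) simp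

  \<comment> \<open>The ground state minimizes the form; the infimum is a true lower bound since the form is nonnegative.\<close>
  define c where "c = spectral_bottom m X P"
  have init: "((\<lambda>t. approx_form m X P t \<phi>\<^sub>0 \<phi>\<^sub>0) \<longlongrightarrow> c) (at_right 0)"
  proof -
    obtain l where l: "((\<lambda>t. approx_form m X P t \<phi>\<^sub>0 \<phi>\<^sub>0) \<longlongrightarrow> l) (at_right 0)"
      using dom by (auto simp: form_domain_def)
    with form_eq[OF l] min show ?thesis by (simp add: c_def)
  qed
  have bdd: "bdd_below {dirichlet_form m X P u u | u. u \<in> form_domain m X P \<and> L2_norm m u = 1}"
  proof (rule bdd_belowI)
    fix r assume "r \<in> {dirichlet_form m X P u u | u. u \<in> form_domain m X P \<and> L2_norm m u = 1}"
    then obtain u l where u: "u \<in> L2 m" and r: "r = dirichlet_form m X P u u"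
      and l: "((\<lambda>t. approx_form m X P t u u) \<longlongrightarrow> l) (at_right 0)"
      by (auto simp: form_domain_def)
    have "\<forall>\<^sub>F t in at_right 0. 0 \<le> approx_form m X P t u u"
      using eventually_at_right_less[of "0::real"]
    proof eventually_elim
      case (elim t)
      then show ?case
        using S.approx_form_nonneg[OF _ u, of t] by (simp add: approx[OF _ u, symmetric])
    qed
    then have "0 \<le> l" by (intro tendsto_lowerbound[OF l]) auto
    then show "0 \<le> r" by (simp add: r form_eq[OF l])
  qed
  have minimal: "c \<le> l" if w: "w \<in> L2 m" "(LINT x|m. w x * w x) = 1"
    and l: "((\<lambda>t. 1 / t * (LINT x|m. (w x - S.act t w x) * w x)) \<longlongrightarrow> l) (at_right 0)" for w l
  proof -
    note l' = l[unfolded approx_lim[OF w(1)]]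
    have "w \<in> form_domain m X P" using w(1) l' by (auto simp: form_domain_def)
    moreover have "L2_norm m w = 1" using w(2) by (simp add: L2_norm_def L2_inner_def)
    ultimately show ?thesis
      unfolding c_def spectral_bottom_def
      by (intro cInf_lower bdd) (use form_eq[OF l'] in auto)
  qed
  have norm': "(LINT x|m. \<phi>\<^sub>0 x * \<phi>\<^sub>0 x) = 1" using norm by (simp add: L2_norm_def L2_inner_def)
  note ev = S.minimizer_is_eigenfunction[OF _ norm' init[folded approx_lim[OF L2]] minimal]
  have c: "0 \<le> c" by (rule ev(1)[where t = 0]) (use L2 bb in auto)
  have eigen: "(\<integral>\<^sup>+y. ennreal (\<phi>\<^sub>0 y) \<partial>transition t x) = ennreal (exp (- c * t)) * ennreal (\<phi>\<^sub>0 x)"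
    if t: "0 < t" for t x
  proof -
    have "S.act t \<phi>\<^sub>0 x = exp (- c * t) * \<phi>\<^sub>0 x"
    proof (rule S.continuous_AE_eqI[OF feller[OF t bb]])
      show "continuous_on UNIV (\<lambda>x. exp (- c * t) * \<phi>\<^sub>0 x)" by (intro continuous_intros cont)
      show "AE x in m. S.act t \<phi>\<^sub>0 x = exp (- c * t) * \<phi>\<^sub>0 x"
        by (rule ev(2)) (use L2 bb t in auto)
    qed
    moreover have "(\<integral>\<^sup>+y. ennreal (\<phi>\<^sub>0 y) \<partial>transition t x) = ennreal (S.act t \<phi>\<^sub>0 x)"
      using S.integrable_Q[OF _ bb] t by (intro nn_integral_eq_integral) auto
    ultimately show ?thesis using pos[of x] by (simp add: ennreal_mult less_imp_le)
  qed

  obtain C where C: "\<And>x. \<bar>\<phi>\<^sub>0 x\<bar> \<le> C" using bounded_borelE[OF bb] by blast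
  have C': "\<phi>\<^sub>0 x \<le> C" for x using C[of x] by linarith
  \<comment> \<open>The tolerance that turns \<open>(1 + c)\<close> times the resolvent off \<open>K\<close> into a contraction by \<open>1/2\<close>.\<close>
  define \<epsilon> where "\<epsilon> = 1 / (2 * (1 + c))"
  have "0 < \<epsilon>" using c by (simp add: \<epsilon>_def)
  then obtain K where K: "compact K" and K_le: "(SUP x. resolvent_op X P 1 (indicator (- K)) x) \<le> \<epsilon>"
    using tight by (auto simp: tight_process_def)
  have K_borel [measurable]: "K \<in> sets borel" using K by (intro borel_closed compact_imp_closed)
  have ind_meas: "(indicator (- K) :: 'a \<Rightarrow> real) \<in> borel_measurable borel" by measurable
  have op_le: "resolvent_op X P 1 (indicator (- K)) x \<le> \<epsilon>" for x
    by (rule order_trans[OF cSUP_upper K_le])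
       (auto intro!: bdd_aboveI2[of _ _ 1] ennreal_resolvent_op_eq(2)[OF ind_meas])
  have res_le: "S.resolvent (indicator (- K)) x \<le> ennreal \<epsilon>" for x
  proof -
    have "S.resolvent (indicator (- K)) x = ennreal (resolvent_op X P 1 (indicator (- K)) x)"
      using ennreal_resolvent_op_eq(1)[OF ind_meas, of x] by (simp add: S.resolvent_def ennreal_indicator)
    then show ?thesis using ennreal_leI[OF op_le] by simp
  qed
  have "(\<integral>\<^sup>+x. ennreal (\<phi>\<^sub>0 x) \<partial>m) < \<infinity>"
    by (rule S.eigenfunction_integrable[OF meas C' c eigen K_borel compact_finite[OF K]])
       (use res_le in \<open>simp_all add: \<epsilon>_def\<close>)
  then have int: "integrable m \<phi>\<^sub>0"
    using meas measurable_cong_sets[OF sets_m refl] by (intro integrableI_nonneg) auto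
  define Z where "Z = (LINT x|m. \<phi>\<^sub>0 x)"
  have Z: "0 < Z"
  proof -
    have "Z \<noteq> 0"
    proof
      assume "Z = 0"
      then have "AE x in m. \<phi>\<^sub>0 x = 0"
        unfolding Z_def using integral_nonneg_eq_0_iff_AE[OF int] by auto
      then have "(LINT x|m. \<phi>\<^sub>0 x * \<phi>\<^sub>0 x) = 0"
        by (intro integral_eq_zero_AE) (auto elim!: eventually_mono)
      with norm' show False by simp
    qed
    moreover have "0 \<le> Z" unfolding Z_def by (intro integral_nonneg_AE) auto
    ultimately show ?thesis by simp
  qed
  define \<psi> where "\<psi> x = \<phi>\<^sub>0 x / Z" for x
  have \<psi>_meas [measurable]: "\<psi> \<in> borel_measurable borel" unfolding \<psi>_def by measurable
  have \<psi>_pos: "0 < \<psi> x" for x using pos Z by (simp add: \<psi>_def)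
  have \<psi>_bound: "\<psi> x \<le> C / Z" for x using C' Z by (simp add: \<psi>_def divide_right_mono)
  have \<psi>_eq: "ennreal (\<psi> x) = ennreal (1 / Z) * ennreal (\<phi>\<^sub>0 x)" for x
    using Z pos[of x] by (simp add: \<psi>_def ennreal_mult[symmetric] less_imp_le)
  have \<phi>_nn: "(\<integral>\<^sup>+x. ennreal (\<phi>\<^sub>0 x) \<partial>m) = ennreal Z"
    unfolding Z_def by (rule nn_integral_eq_integral[OF int]) auto
  have \<psi>_int: "(\<integral>\<^sup>+x. ennreal (\<psi> x) \<partial>m) = 1"
    unfolding \<psi>_eq using Z by (subst nn_integral_cmult) (simp_all add: \<phi>_nn sets_m ennreal_mult[symmetric])
  have \<psi>_eigen: "(\<integral>\<^sup>+y. ennreal (\<psi> y) \<partial>transition t x) = ennreal (exp (- c * t)) * ennreal (\<psi> x)" if "0 \<le> t" for t x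
  proof (cases "t = 0")
    case True
    then show ?thesis by (simp add: transition_0 nn_integral_return)
  next
    case False
    with that show ?thesis
      unfolding \<psi>_eq by (subst nn_integral_cmult) (simp_all add: eigen mult_ac)
  qed
  have normalized: "normalized_measure m \<phi>\<^sub>0 = density m (\<lambda>x. ennreal (\<psi> x))"
    by (simp add: normalized_measure_def \<psi>_def Z_def)

  have prob: "prob_space (density m (\<lambda>x. ennreal (\<psi> x)))"
    by (rule prob_spaceI) (simp add: emeasure_density \<psi>_int sets_m)
  have exists: "quasi_stationary M X P (density m (\<lambda>x. ennreal (\<psi> x)))"
  proof -
    let ?\<nu> = "density m (\<lambda>x. ennreal (\<psi> x))"
    interpret \<nu>: prob_space ?\<nu> by (rule prob)
    have sets_\<nu>: "sets ?\<nu> = sets borel" by (simp add: sets_m)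
    have ip: "initial_prob P ?\<nu> {\<omega> \<in> space M. X t \<omega> \<in> Some ` B} = exp (- c * t) * measure ?\<nu> B"
      if t: "0 \<le> t" and B: "B \<in> sets borel" for t B
    proof -
      have "ennreal (initial_prob P ?\<nu> {\<omega> \<in> space M. X t \<omega> \<in> Some ` B}) = (\<integral>\<^sup>+x. emeasure (transition t x) B \<partial>?\<nu>)"
        by (rule ennreal_initial_prob[OF t B prob sets_\<nu>])
      also have "\<dots> = (\<integral>\<^sup>+x. ennreal (\<psi> x) * (\<integral>\<^sup>+y. indicator B y \<partial>transition t x) \<partial>m)"
        using S.nn_integral_Q_measurable[OF t, of "indicator B"] B measurable_cong_sets[OF sets_m refl]
        by (subst nn_integral_density) (auto simp: sets_m)
      also have "\<dots> = (\<integral>\<^sup>+x. indicator B x * (\<integral>\<^sup>+y. ennreal (\<psi> y) \<partial>transition t x) \<partial>m)"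
        using B by (intro S.nn_symmetric t) auto
      also have "\<dots> = (\<integral>\<^sup>+x. ennreal (exp (- c * t)) * (ennreal (\<psi> x) * indicator B x) \<partial>m)"
        by (simp add: \<psi>_eigen[OF t] mult_ac)
      also have "\<dots> = ennreal (exp (- c * t)) * emeasure ?\<nu> B"
        using B by (subst nn_integral_cmult) (auto simp: emeasure_density sets_m)
      also have "\<dots> = ennreal (exp (- c * t) * measure ?\<nu> B)"
        by (simp add: \<nu>.emeasure_eq_measure ennreal_mult)
      finally show ?thesis
        by (subst (asm) ennreal_inj) (auto simp: initial_prob_def intro!: integral_nonneg_AE)
    qed
    have "initial_prob P ?\<nu> {\<omega> \<in> space M. X t \<omega> \<in> range Some} = exp (- c * t)" if "0 \<le> t" for t
      using ip[OF that, of UNIV] \<nu>.prob_space by simp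
    then show ?thesis
      unfolding quasi_stationary_def using prob sets_\<nu> by (simp add: ip)
  qed
  have unique: "\<nu> = density m (\<lambda>x. ennreal (\<psi> x))" if qs: "quasi_stationary M X P \<nu>" for \<nu>
  proof -
    have \<nu>: "prob_space \<nu>" "sets \<nu> = sets borel" using qs by (auto simp: quasi_stationary_def)
    interpret \<nu>: prob_space \<nu> by (rule \<nu>(1))
    have sp: "space \<nu> = UNIV" using sets_eq_imp_space_eq[OF \<nu>(2)] by simp
    define a where "a t = initial_prob P \<nu> {\<omega> \<in> space M. X t \<omega> \<in> range Some}" for t
    have quot: "measure \<nu> B = initial_prob P \<nu> {\<omega> \<in> space M. X t \<omega> \<in> Some ` B} / a t"
      if "0 \<le> t" "B \<in> sets borel" for t B
      using qs that by (simp add: quasi_stationary_def a_def)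
    \<comment> \<open>If the process were dead almost surely, the quotient would give \<open>E\<close> mass \<open>0\<close> instead of \<open>1\<close>.\<close>
    have a_pos: "0 < a t" if "0 \<le> t" for t
    proof -
      have "a t \<noteq> 0" using quot[OF that, of UNIV] \<nu>.prob_space sp by auto
      moreover have "0 \<le> a t" unfolding a_def initial_prob_def by (intro integral_nonneg_AE) simp
      ultimately show ?thesis by simp
    qed
    show ?thesis
    proof (rule S.quasi_stationary_unique[OF _ \<psi>_meas \<psi>_pos \<psi>_bound \<psi>_int \<psi>_eigen \<nu>])
      show S.irreducible
        unfolding S.irreducible_def
      proof (intro ballI impI)
        fix A :: "'a set"
        assume A: "A \<in> sets borel" and inv: "\<forall>f\<in>L2 m \<inter> bounded_borel. \<forall>t>0.
            AE x in m. S.act t (\<lambda>y. indicator A y * f y) x = indicator A x * S.act t f x"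
        have "AE x in m. semigroup_op X P t (\<lambda>y. indicator A y * f y) x = indicator A x * semigroup_op X P t f x"
          if f: "f \<in> L2 m \<inter> bounded_borel" and t: "0 < t" for f t
        proof -
          have f_meas: "f \<in> borel_measurable borel" using f by (auto simp: bounded_borel_def)
          then have Af_meas: "(\<lambda>y. indicator A y * f y) \<in> borel_measurable borel" using A by measurable
          have "AE x in m. S.act t (\<lambda>y. indicator A y * f y) x = indicator A x * S.act t f x"
            using inv f t by blast
          then show ?thesis
            by (simp only: act[OF less_imp_le[OF t] f_meas] act[OF less_imp_le[OF t] Af_meas])
        qed
        then show "emeasure m A = 0 \<or> emeasure m (- A) = 0"
          using irr A unfolding irreducible_process_def by blast
      qed
      show "(\<integral>\<^sup>+x. emeasure (transition t x) B \<partial>\<nu>) = ennreal (a t) * emeasure \<nu> B" if "0 < t" "B \<in> sets borel" for t B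
      proof -
        have "initial_prob P \<nu> {\<omega> \<in> space M. X t \<omega> \<in> Some ` B} = a t * measure \<nu> B"
          using quot[of t B] a_pos[of t] that by (simp add: field_simps)
        then have "(\<integral>\<^sup>+x. emeasure (transition t x) B \<partial>\<nu>) = ennreal (a t * measure \<nu> B)"
          using ennreal_initial_prob[OF _ that(2) \<nu>, of t] that by simp
        then show ?thesis using a_pos[of t] that by (simp add: \<nu>.emeasure_eq_measure ennreal_mult)
      qed
    qed (use a_pos in auto)
  qed
  show ?thesis
    unfolding normalized using exists unique by blast
qed

end
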